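(* The category $\mathbf{Top_S}$ of topological spaces and sober maps is equivalent to the opposite of the category $\mathbf{SMT_P}$ of spatial MT-algebras and proximity morphisms. The equivalence sends a space $X$ to $\mathcal P X$, a sober map $f:X\rightsquigarrow Y$ to the proximity morphism $\mathcal P Y\to\mathcal P X$ determined by $U\mapsto\{x\in X: U\in f(x)\}$ on open sets $U$ of $Y$, a spatial MT-algebra $M$ to $\mathrm{at}\,M$, and a proximity morphism $g:M\to N$ to the sober map $\mathrm{at}\,N\rightsquigarrow\mathrm{at}\,M$, $y\mapsto\{\eta_M(a): a\in\mathcal O M,\ y\le g(a)\}$.
   Context: For a space $X$, $\Omega X$ is its frame of opens, $\mathrm{pt}\,L$ the space of completely prime filters of a frame $L$ (opens $\{P: a\in P\}$), and $s X=\mathrm{pt}\,\Omega X$ the soberification with $\lambda_X:X\to sX$, $\lambda_X(x)=\{U\in\Omega X: x\in U\}$; $s$ is a functor, and $\lambda_{sZ}$ is a homeomorphism. A sober map $f:X\rightsquigarrow Y$ is a continuous map $f:X\to sY$. The composite of $f:X\rightsquigarrow Y$ and $g:Y\rightsquigarrow Z$ is $g\bullet f=\lambda_{sZ}^{-1}\circ sg\circ f$, and the identity on $X$ is $\lambda_X$; this defines $\mathbf{Top_S}$. An MT-algebra is a complete boolean algebra $M$ with $\square$ satisfying $\square1=1$, $\square(a\wedge b)=\square a\wedge\square b$, $\square a\le a$, $\square a\le\square\square a$; $\Diamond=\neg\square\neg$; open: $\square a=a$; locally closed: $a=\square b\wedge\Diamond c$; $\mathcal OM$, $\mathcal{LC}M$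 as usual. $\mathcal PX$ is the powerset of $X$ with topological interior. $\mathrm{at}\,M$ is the set of atoms with topology $\{\eta_M(u):u\in\mathcal OM\}$, $\eta_M(a)=\{x\in\mathrm{at}\,M:x\le a\}$; $M$ is spatial if $\eta_M$ is injective. A proximity morphism $f:M\to N$ is a map with (P1) $f|_{\mathcal O M}:\mathcal O M\to\mathcal O N$ a frame morphism; (P2) $f(a\wedge b)=f(a)\wedge f(b)$; (P3) $f(\bigvee S)=\bigvee f[S]$ for finite $S\subseteq\mathcal{LC}M$; (P4) $f(a)=\bigvee\{f(x):x\in\mathcal{LC}M,x\le a\}$. Proximity morphisms compose by $(g\star f)(a)=\bigvee\{g(f(x)):x\in\mathcal{LC}M_1,x\le a\}$ with identities $1_M(a)=\bigvee\{x\in\mathcal{LC}M:x\le a\}$; a proximity morphism is determined by its values on open elements. *)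

theory Defs
  imports "HOL-Analysis.Abstract_Topology"
begin

record 'm mtalg =
  mcar :: "'m set"
  mle  :: "'m \<Rightarrow> 'm \<Rightarrow> bool"
  mbox :: "'m \<Rightarrow> 'm"

definition is_lub :: "'m mtalg \<Rightarrow> 'm set \<Rightarrow> 'm \<Rightarrow> bool" where
  "is_lub M S a \<longleftrightarrow> a \<in> mcar M \<and> (\<forall>s\<in>S. mle M s a) \<and>
     (\<forall>b\<in>mcar M. (\<forall>s\<in>S. mle M s b) \<longrightarrow> mle M a b)"

definition is_glb :: "'m mtalg \<Rightarrow> 'm set \<Rightarrow> 'm \<Rightarrow> bool" where
  "is_glb M S a \<longleftrightarrow> a \<in> mcar M \<and> (\<forall>s\<in>S. mle M a s) \<and>
     (\<forall>b\<in>mcar M. (\<forall>s\<in>S. mle M b s) \<longrightarrow> mle M b a)"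

definition msup :: "'m mtalg \<Rightarrow> 'm set \<Rightarrow> 'm" where
  "msup M S = (THE a. is_lub M S a)"

definition minf :: "'m mtalg \<Rightarrow> 'm set \<Rightarrow> 'm" where
  "minf M S = (THE a. is_glb M S a)"

definition mjoin :: "'m mtalg \<Rightarrow> 'm \<Rightarrow> 'm \<Rightarrow> 'm" where
  "mjoin M a b = msup M {a, b}"

definition mmeet :: "'m mtalg \<Rightarrow> 'm \<Rightarrow> 'm \<Rightarrow> 'm" where
  "mmeet M a b = minf M {a, b}"

definition mtop :: "'m mtalg \<Rightarrow> 'm" where
  "mtop M = minf M {}"

definition mbot :: "'m mtalg \<Rightarrow> 'm" where
  "mbot M = msup M {}"

definition mneg :: "'m mtalg \<Rightarrow> 'm \<Rightarrow> 'm" where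
  "mneg M a = (THE b. b \<in> mcar M \<and> mmeet M a b = mbot M \<and> mjoin M a b = mtop M)"

definition mdia :: "'m mtalg \<Rightarrow> 'm \<Rightarrow> 'm" where
  "mdia M a = mneg M (mbox M (mneg M a))"

definition complete_ba :: "'m mtalg \<Rightarrow> bool" where
  "complete_ba M \<longleftrightarrow>
     (\<forall>a\<in>mcar M. mle M a a) \<and>
     (\<forall>a\<in>mcar M. \<forall>b\<in>mcar M. mle M a b \<and> mle M b a \<longrightarrow> a = b) \<and>
     (\<forall>a\<in>mcar M. \<forall>b\<in>mcar M. \<forall>c\<in>mcar M. mle M a b \<and> mle M b c \<longrightarrow> mle M a c) \<and>
     (\<forall>S. S \<subseteq> mcar M \<longrightarrow> (\<exists>a. is_lub M S a)) \<and>
     (\<forall>a\<in>mcar M. \<forall>b\<in>mcar M. \<forall>c\<in>mcar M.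
        mmeet M a (mjoin M b c) = mjoin M (mmeet M a b) (mmeet M a c)) \<and>
     (\<forall>a\<in>mcar M. \<exists>b\<in>mcar M. mmeet M a b = mbot M \<and> mjoin M a b = mtop M)"

definition mt_algebra :: "'m mtalg \<Rightarrow> bool" where
  "mt_algebra M \<longleftrightarrow> complete_ba M \<and>
     (\<forall>a\<in>mcar M. mbox M a \<in> mcar M) \<and>
     mbox M (mtop M) = mtop M \<and>
     (\<forall>a\<in>mcar M. \<forall>b\<in>mcar M. mbox M (mmeet M a b) = mmeet M (mbox M a) (mbox M b)) \<and>
     (\<forall>a\<in>mcar M. mle M (mbox M a) a) \<and>
     (\<forall>a\<in>mcar M. mle M (mbox M a) (mbox M (mbox M a)))"

definition mopen :: "'m mtalg \<Rightarrow> 'm \<Rightarrow> bool" where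
  "mopen M a \<longleftrightarrow> a \<in> mcar M \<and> mbox M a = a"

definition LC :: "'m mtalg \<Rightarrow> 'm set" where
  "LC M = {a \<in> mcar M. \<exists>b\<in>mcar M. \<exists>c\<in>mcar M. a = mmeet M (mbox M b) (mdia M c)}"

definition atom :: "'m mtalg \<Rightarrow> 'm \<Rightarrow> bool" where
  "atom M x \<longleftrightarrow> x \<in> mcar M \<and> x \<noteq> mbot M \<and>
     (\<forall>y\<in>mcar M. mle M y x \<longrightarrow> y = mbot M \<or> y = x)"

definition eta :: "'m mtalg \<Rightarrow> 'm \<Rightarrow> 'm set" where
  "eta M a = {x. atom M x \<and> mle M x a}"

definition spatial_mt :: "'m mtalg \<Rightarrow> bool" where
  "spatial_mt M \<longleftrightarrow> mt_algebra M \<and> inj_on (eta M) (mcar M)"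

definition atsp :: "'m mtalg \<Rightarrow> 'm topology" where
  "atsp M = topology (\<lambda>S. \<exists>u. mopen M u \<and> S = eta M u)"

definition powalg :: "'a topology \<Rightarrow> 'a set mtalg" where
  "powalg X = \<lparr>mcar = Pow (topspace X), mle = (\<subseteq>), mbox = (\<lambda>A. X interior_of A)\<rparr>"

definition proximity :: "'m mtalg \<Rightarrow> 'n mtalg \<Rightarrow> ('m \<Rightarrow> 'n) \<Rightarrow> bool" where
  "proximity M N f \<longleftrightarrow> mt_algebra M \<and> mt_algebra N \<and>
     (\<forall>a\<in>mcar M. f a \<in> mcar N) \<and>
     \<comment> \<open>(P1) restriction to opens is a frame morphism O M -> O N
        (binary meets are covered by (P2))\<close>
     (\<forall>u. mopen M u \<longrightarrow> mopen N (f u)) \<and>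
     f (mtop M) = mtop N \<and>
     (\<forall>S. S \<subseteq> {u. mopen M u} \<longrightarrow> f (msup M S) = msup N (f ` S)) \<and>
     \<comment> \<open>(P2)\<close>
     (\<forall>a\<in>mcar M. \<forall>b\<in>mcar M. f (mmeet M a b) = mmeet N (f a) (f b)) \<and>
     \<comment> \<open>(P3)\<close>
     (\<forall>S. finite S \<and> S \<subseteq> LC M \<longrightarrow> f (msup M S) = msup N (f ` S)) \<and>
     \<comment> \<open>(P4)\<close>
     (\<forall>a\<in>mcar M. f a = msup N (f ` {x \<in> LC M. mle M x a}))"

definition pcomp :: "'m mtalg \<Rightarrow> 'k mtalg \<Rightarrow> ('n \<Rightarrow> 'k) \<Rightarrow> ('m \<Rightarrow> 'n) \<Rightarrow> 'm \<Rightarrow> 'k" where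
  "pcomp M K g f a = msup K ((\<lambda>x. g (f x)) ` {x \<in> LC M. mle M x a})"

definition pid :: "'m mtalg \<Rightarrow> 'm \<Rightarrow> 'm" where
  "pid M a = msup M {x \<in> LC M. mle M x a}"

definition prox_det :: "'m mtalg \<Rightarrow> 'n mtalg \<Rightarrow> ('m \<Rightarrow> 'n) \<Rightarrow> 'm \<Rightarrow> 'n" where
  "prox_det M N \<phi> = (SOME h. proximity M N h \<and> (\<forall>u. mopen M u \<longrightarrow> h u = \<phi> u))"

definition prox_iso :: "'m mtalg \<Rightarrow> 'n mtalg \<Rightarrow> ('m \<Rightarrow> 'n) \<Rightarrow> bool" where
  "prox_iso M N h \<longleftrightarrow> proximity M N h \<and>
     (\<exists>k. proximity N M k \<and> (\<forall>a\<in>mcar M. pcomp M M k h a = pid M a) \<and>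
          (\<forall>b\<in>mcar N. pcomp N N h k b = pid N b))"

definition cpf :: "'a topology \<Rightarrow> 'a set set \<Rightarrow> bool" where
  "cpf X P \<longleftrightarrow> P \<subseteq> {U. openin X U} \<and> topspace X \<in> P \<and>
     (\<forall>U V. U \<in> P \<and> openin X V \<and> U \<subseteq> V \<longrightarrow> V \<in> P) \<and>
     (\<forall>U V. U \<in> P \<and> V \<in> P \<longrightarrow> U \<inter> V \<in> P) \<and>
     (\<forall>S. S \<subseteq> {U. openin X U} \<and> \<Union>S \<in> P \<longrightarrow> (\<exists>U\<in>S. U \<in> P))"

definition sob :: "'a topology \<Rightarrow> 'a set set topology" where
  "sob X = topology (\<lambda>S. \<exists>U. openin X U \<and> S = {P. cpf X P \<and> U \<in> P})"

definition lam :: "'a topology \<Rightarrow> 'a \<Rightarrow> 'a set set" where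
  "lam X x = {U. openin X U \<and> x \<in> U}"

definition smap :: "'a topology \<Rightarrow> 'b topology \<Rightarrow> ('a \<Rightarrow> 'b) \<Rightarrow> 'a set set \<Rightarrow> 'b set set" where
  "smap X Y f P = {V. openin Y V \<and> {x \<in> topspace X. f x \<in> V} \<in> P}"

definition sober_map :: "'a topology \<Rightarrow> 'b topology \<Rightarrow> ('a \<Rightarrow> 'b set set) \<Rightarrow> bool" where
  "sober_map X Y f \<longleftrightarrow> continuous_map X (sob Y) f"

definition scomp :: "'b topology \<Rightarrow> 'c topology \<Rightarrow> ('b \<Rightarrow> 'c set set) \<Rightarrow> ('a \<Rightarrow> 'b set set)
    \<Rightarrow> 'a \<Rightarrow> 'c set set" where
  "scomp Y Z g f = (\<lambda>x. inv_into (topspace (sob Z)) (lam (sob Z)) (smap Y (sob Z) g (f x)))"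

definition sober_iso :: "'a topology \<Rightarrow> 'b topology \<Rightarrow> ('a \<Rightarrow> 'b set set) \<Rightarrow> bool" where
  "sober_iso X Y e \<longleftrightarrow> sober_map X Y e \<and>
     (\<exists>d. sober_map Y X d \<and> (\<forall>x\<in>topspace X. scomp Y X d e x = lam X x) \<and>
          (\<forall>y\<in>topspace Y. scomp X Y e d y = lam Y y))"

definition Pmor :: "'a topology \<Rightarrow> 'b topology \<Rightarrow> ('a \<Rightarrow> 'b set set) \<Rightarrow> 'b set \<Rightarrow> 'a set" where
  "Pmor X Y f = prox_det (powalg Y) (powalg X) (\<lambda>U. {x \<in> topspace X. U \<in> f x})"

definition atmor :: "'m mtalg \<Rightarrow> 'n mtalg \<Rightarrow> ('m \<Rightarrow> 'n) \<Rightarrow> 'n \<Rightarrow> 'm set set" where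
  "atmor M N g = (\<lambda>y. {eta M a | a. mopen M a \<and> mle N y (g a)})"

definition unitS :: "'a topology \<Rightarrow> 'a \<Rightarrow> 'a set set set" where
  "unitS X = (\<lambda>x. lam (atsp (powalg X)) {x})"

definition counitP :: "'m mtalg \<Rightarrow> 'm \<Rightarrow> 'm set" where
  "counitP M = prox_det M (powalg (atsp M)) (eta M)"

end

theory Submission
  imports Defs
begin

text \<open>A spatial MT-algebra is carried by \<open>\<eta>\<close> isomorphically onto the powerset of its
  space of atoms, with \<open>\<box>\<close> becoming the interior. So all algebras may be treated as powersets of
  topological spaces, whose locally closed elements are the differences \<open>U - V\<close> of open sets. A
  proximity morphism \<open>g\<close> sends \<open>U - V\<close> to \<open>g U - g V\<close> and hence \<open>A\<close> to the union of the
  \<open>g U - g V\<close> with \<open>U - V \<subseteq> A\<close>; composites and identities have the same form, so every equation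
  between proximity morphisms reduces to open elements, where composition is the usual one.
  Conversely, a sober map \<open>f\<close> extends from opens by letting \<open>x\<close> belong to the image of \<open>A\<close> iff
  there is \<open>U - V \<subseteq> A\<close> with \<open>U \<in> f x\<close> and \<open>V \<notin> f x\<close>; preservation of finite joins of locally
  closed sets comes from primeness of the filter \<open>f x\<close>.\<close>

section \<open>Representing MT-algebras by powersets\<close>

text \<open>One setting for both kinds of algebra: \<open>e\<close> is the identity for
  \<open>powalg X\<close> and \<open>eta M\<close> for a spatial \<open>M\<close>. The MT-algebra
  laws are not assumed; they are transported from the powerset along \<open>e\<close>.\<close>

locale mt_rep =
  fixes M :: "'m mtalg" and X :: "'a topology" and e :: "'m \<Rightarrow> 'a set"
  assumes bij: "bij_betw e (mcar M) (Pow (topspace X))"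
    and le_iff: "a \<in> mcar M \<Longrightarrow> b \<in> mcar M \<Longrightarrow> mle M a b \<longleftrightarrow> e a \<subseteq> e b"
    and box_closed: "a \<in> mcar M \<Longrightarrow> mbox M a \<in> mcar M"
    and e_box: "a \<in> mcar M \<Longrightarrow> e (mbox M a) = X interior_of e a"
begin

lemma eq_iff: "a \<in> mcar M \<Longrightarrow> b \<in> mcar M \<Longrightarrow> a = b \<longleftrightarrow> e a = e b"
  using bij by (meson bij_betw_imp_inj_on inj_onD)

lemma e_subset: "a \<in> mcar M \<Longrightarrow> e a \<subseteq> topspace X"
  using bij bij_betwE by fastforce

lemma obtain_rep:
  assumes "A \<subseteq> topspace X" obtains a where "a \<in> mcar M" "e a = A"
  using assms bij by (metis PowI bij_betw_imp_surj_on imageE)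

lemma is_lub_iff:
  assumes "S \<subseteq> mcar M"
  shows "is_lub M S a \<longleftrightarrow> a \<in> mcar M \<and> e a = \<Union>(e ` S)"
proof -
  have S: "s \<in> mcar M" if "s \<in> S" for s using assms that by blast
  \<comment> \<open>The union is itself represented, so it competes as an upper bound, and leastness
    forces \<open>e a\<close> to equal it.\<close>
  obtain b where b: "b \<in> mcar M" "e b = \<Union>(e ` S)"
    using obtain_rep[of "\<Union>(e ` S)"] assms e_subset by blast
  have "is_lub M S a \<longleftrightarrow> a \<in> mcar M \<and> \<Union>(e ` S) \<subseteq> e a \<and>
      (\<forall>b\<in>mcar M. \<Union>(e ` S) \<subseteq> e b \<longrightarrow> e a \<subseteq> e b)"
    unfolding is_lub_def UN_subset_iff by (simp add: S le_iff cong: conj_cong ball_cong)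
  then show ?thesis using b by blast
qed

text \<open>Dual of \<open>is_lub_iff\<close>; the factor \<open>topspace X\<close> supplies the
  right value for empty \<open>S\<close>, where \<open>\<Inter>\<close> alone would be the whole
  type.\<close>

lemma is_glb_iff:
  assumes "S \<subseteq> mcar M"
  shows "is_glb M S a \<longleftrightarrow> a \<in> mcar M \<and> e a = topspace X \<inter> \<Inter>(e ` S)"
proof -
  have S: "s \<in> mcar M" if "s \<in> S" for s using assms that by blast
  obtain b where b: "b \<in> mcar M" "e b = topspace X \<inter> \<Inter>(e ` S)"
    using obtain_rep[of "topspace X \<inter> \<Inter>(e ` S)"] by blast
  have sub: "e c \<subseteq> e b \<longleftrightarrow> (\<forall>s\<in>S. e c \<subseteq> e s)" if "c \<in> mcar M" for c
    using e_subset[OF that] b by blast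
  have "is_glb M S a \<longleftrightarrow> a \<in> mcar M \<and> e a \<subseteq> e b \<and> (\<forall>c\<in>mcar M. e c \<subseteq> e b \<longrightarrow> e c \<subseteq> e a)"
    unfolding is_glb_def by (simp add: S sub le_iff cong: conj_cong ball_cong)
  then show ?thesis using b by blast
qed

lemma msup: assumes "S \<subseteq> mcar M"
  shows "msup M S \<in> mcar M" "e (msup M S) = \<Union>(e ` S)"
proof -
  obtain b where b: "b \<in> mcar M" "e b = \<Union>(e ` S)"
    using obtain_rep[of "\<Union>(e ` S)"] assms e_subset by blast
  have "is_lub M S (msup M S)"
    unfolding msup_def
    by (rule theI[of _ b]) (use b is_lub_iff[OF assms] eq_iff in auto)
  then show "msup M S \<in> mcar M" "e (msup M S) = \<Union>(e ` S)"
    using is_lub_iff[OF assms] by auto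
qed

lemma minf: assumes "S \<subseteq> mcar M"
  shows "minf M S \<in> mcar M" "e (minf M S) = topspace X \<inter> \<Inter>(e ` S)"
proof -
  obtain b where b: "b \<in> mcar M" "e b = topspace X \<inter> \<Inter>(e ` S)"
    using obtain_rep[of "topspace X \<inter> \<Inter>(e ` S)"] by blast
  have "is_glb M S (minf M S)"
    unfolding minf_def
    by (rule theI[of _ b]) (use b is_glb_iff[OF assms] eq_iff in auto)
  then show "minf M S \<in> mcar M" "e (minf M S) = topspace X \<inter> \<Inter>(e ` S)"
    using is_glb_iff[OF assms] by auto
qed

lemma bot_top:
  "mbot M \<in> mcar M" "e (mbot M) = {}" "mtop M \<in> mcar M" "e (mtop M) = topspace X"
  using msup[of "{}"] minf[of "{}"] by (auto simp: mbot_def mtop_def)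

lemma join:
  assumes "a \<in> mcar M" "b \<in> mcar M"
  shows "mjoin M a b \<in> mcar M" "e (mjoin M a b) = e a \<union> e b"
  using msup[of "{a, b}"] assms by (auto simp: mjoin_def)

lemma meet:
  assumes "a \<in> mcar M" "b \<in> mcar M"
  shows "mmeet M a b \<in> mcar M" "e (mmeet M a b) = e a \<inter> e b"
  using minf[of "{a, b}"] assms e_subset[of a] by (auto simp: mmeet_def)

lemma complement_iff:
  assumes "a \<in> mcar M" "b \<in> mcar M"
  shows "mmeet M a b = mbot M \<and> mjoin M a b = mtop M \<longleftrightarrow> e b = topspace X - e a"
  using eq_iff[of "mmeet M a b" "mbot M"] eq_iff[of "mjoin M a b" "mtop M"]
    meet[OF assms] join[OF assms] bot_top e_subset[OF assms(1)] e_subset[OF assms(2)] by auto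

lemma neg:
  assumes "a \<in> mcar M"
  shows "mneg M a \<in> mcar M" "e (mneg M a) = topspace X - e a"
proof -
  obtain b where b: "b \<in> mcar M" "e b = topspace X - e a"
    using obtain_rep[of "topspace X - e a"] by blast
  have "mneg M a \<in> mcar M \<and> mmeet M a (mneg M a) = mbot M \<and> mjoin M a (mneg M a) = mtop M"
    unfolding mneg_def
  proof (rule theI[of _ b])
    show "b \<in> mcar M \<and> mmeet M a b = mbot M \<and> mjoin M a b = mtop M"
      using b complement_iff[OF assms] by blast
    show "c = b" if "c \<in> mcar M \<and> mmeet M a c = mbot M \<and> mjoin M a c = mtop M" for c
      using that b complement_iff[OF assms, of c] eq_iff[of c b] by auto
  qed
  then show "mneg M a \<in> mcar M" "e (mneg M a) = topspace X - e a"
    using complement_iff[OF assms] by auto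
qed

lemma dia:
  assumes "a \<in> mcar M"
  shows "mdia M a \<in> mcar M" "e (mdia M a) = X closure_of e a"
  unfolding mdia_def
  using neg box_closed e_box assms interior_of_complement[of X "e a"]
    closure_of_subset_topspace[of X "e a"] by auto

lemma complete_ba: "complete_ba M"
  unfolding complete_ba_def
proof (intro conjI ballI allI impI)
  fix S assume "S \<subseteq> mcar M"
  then show "\<exists>a. is_lub M S a" using is_lub_iff msup by blast
next
  fix a b c assume "a \<in> mcar M" "b \<in> mcar M" "c \<in> mcar M"
  then show "mmeet M a (mjoin M b c) = mjoin M (mmeet M a b) (mmeet M a c)"
    by (simp add: eq_iff meet join Int_Un_distrib)
next
  fix a assume "a \<in> mcar M"
  then show "\<exists>b\<in>mcar M. mmeet M a b = mbot M \<and> mjoin M a b = mtop M"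
    using complement_iff neg by blast
qed (auto simp: le_iff eq_iff)

lemma mt_algebra: "mt_algebra M"
  unfolding mt_algebra_def
  using complete_ba
  by (auto simp: box_closed bot_top eq_iff e_box meet le_iff interior_of_Int interior_of_subset)

lemma mopen_iff: "mopen M u \<longleftrightarrow> u \<in> mcar M \<and> openin X (e u)"
  unfolding mopen_def using box_closed e_box eq_iff interior_of_eq by metis

lemma obtain_mopen:
  assumes "openin X U" obtains u where "mopen M u" "e u = U"
  using assms obtain_rep mopen_iff openin_subset by metis

text \<open>Closed sets are complements of opens: \<open>mdia M c\<close> is the complement of the
  open \<open>mbox M (mneg M c)\<close>, and conversely removing an open \<open>v\<close> is meeting
  with \<open>mdia M (mneg M v)\<close>.\<close>

lemma LC_iff: "x \<in> LC M \<longleftrightarrow> x \<in> mcar M \<and> (\<exists>u v. mopen M u \<and> mopen M v \<and> e x = e u - e v)"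
proof
  assume "x \<in> LC M"
  then obtain b c where x: "x \<in> mcar M" "b \<in> mcar M" "c \<in> mcar M"
    "x = mmeet M (mbox M b) (mdia M c)"
    unfolding LC_def by auto
  let ?v = "mbox M (mneg M c)"
  have "e x = e (mbox M b) - e ?v"
    using x e_subset[of "mbox M b"] by (auto simp: meet box_closed mdia_def neg)
  moreover have "mopen M (mbox M b)" "mopen M ?v"
    using x by (auto simp: mopen_iff box_closed neg e_box)
  ultimately show "x \<in> mcar M \<and> (\<exists>u v. mopen M u \<and> mopen M v \<and> e x = e u - e v)"
    using x by blast
next
  assume "x \<in> mcar M \<and> (\<exists>u v. mopen M u \<and> mopen M v \<and> e x = e u - e v)"
  then obtain u v where x: "x \<in> mcar M" "mopen M u" "mopen M v" "e x = e u - e v" by blast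
  then have uv: "u \<in> mcar M" "v \<in> mcar M" "openin X (e u)" "openin X (e v)"
    by (auto simp: mopen_iff)
  have "x = mmeet M (mbox M u) (mdia M (mneg M v))"
    using x uv e_subset[OF uv(1)]
    by (auto simp: eq_iff meet box_closed dia neg e_box interior_of_openin closure_of_complement)
  then show "x \<in> LC M"
    unfolding LC_def using x uv neg by blast
qed

lemma LC_mcar: "x \<in> LC M \<Longrightarrow> x \<in> mcar M"
  by (simp add: LC_iff)

lemma mopen_LC: "mopen M u \<Longrightarrow> u \<in> LC M"
  unfolding LC_iff using mopen_iff bot_top by (metis Diff_empty openin_empty)

end

text \<open>Indexes the locally closed elements below \<open>a\<close> by pairs of opens
  representing them, so that a union over this set involves only values on opens. One element may
  come from many pairs.\<close>

definition pairs_below :: "'m mtalg \<Rightarrow> ('m \<Rightarrow> 'a set) \<Rightarrow> 'm \<Rightarrow> ('m \<times> 'm) set" where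
  "pairs_below M e a = {(u, v). mopen M u \<and> mopen M v \<and> e u - e v \<subseteq> e a}"

text \<open>Proximity morphisms, their composites and the identities are all of this form, hence they
  are compared on opens only.\<close>
lemma sup_LC_eq:
  assumes M: "mt_rep M Y e" and N: "mt_rep N X d" and a: "a \<in> mcar M"
    and F: "\<And>c u v. c \<in> mcar M \<Longrightarrow> mopen M u \<Longrightarrow> mopen M v \<Longrightarrow> e c = e u - e v \<Longrightarrow>
              F c \<in> mcar N \<and> d (F c) = G u - G v"
  shows "msup N (F ` {x \<in> LC M. mle M x a}) \<in> mcar N"
    and "d (msup N (F ` {x \<in> LC M. mle M x a})) = (\<Union>(u, v)\<in>pairs_below M e a. G u - G v)"
proof -
  interpret M: mt_rep M Y e by (rule M)
  interpret N: mt_rep N X d by (rule N)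
  have sub: "F ` {x \<in> LC M. mle M x a} \<subseteq> mcar N"
    using F M.LC_iff by blast
  show "msup N (F ` {x \<in> LC M. mle M x a}) \<in> mcar N"
    by (rule N.msup[OF sub])
  have "(\<Union>x\<in>{x \<in> LC M. mle M x a}. d (F x)) = (\<Union>(u, v)\<in>pairs_below M e a. G u - G v)"
    (is "?L = ?R")
  proof
    show "?L \<subseteq> ?R"
    proof
      fix y assume "y \<in> ?L"
      then obtain x where x: "x \<in> LC M" "mle M x a" "y \<in> d (F x)" by blast
      then obtain u v where uv: "x \<in> mcar M" "mopen M u" "mopen M v" "e x = e u - e v"
        using M.LC_iff by blast
      then have "(u, v) \<in> pairs_below M e a"
        using x a M.le_iff by (auto simp: pairs_below_def)
      moreover have "y \<in> G u - G v" using F[OF uv] x by simp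
      ultimately show "y \<in> ?R" by blast
    qed
    show "?R \<subseteq> ?L"
    proof
      fix y assume "y \<in> ?R"
      then obtain u v where uv: "mopen M u" "mopen M v" "e u - e v \<subseteq> e a" "y \<in> G u - G v"
        unfolding pairs_below_def by blast
      obtain x where x: "x \<in> mcar M" "e x = e u - e v"
        using uv M.e_subset[of u] M.mopen_iff[of u] M.obtain_rep[of "e u - e v"] by blast
      have "x \<in> LC M" "mle M x a" using x uv a M.LC_iff M.le_iff by auto
      moreover have "y \<in> d (F x)" using F[OF x(1) uv(1,2) x(2)] uv by simp
      ultimately show "y \<in> ?L" by blast
    qed
  qed
  then show "d (msup N (F ` {x \<in> LC M. mle M x a})) = (\<Union>(u, v)\<in>pairs_below M e a. G u - G v)"
    by (simp add: N.msup[OF sub])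
qed

lemma pid_rep:
  assumes M: "mt_rep M X e" and a: "a \<in> mcar M"
  shows "pid M a \<in> mcar M" and "e (pid M a) = (\<Union>(u, v)\<in>pairs_below M e a. e u - e v)"
  using sup_LC_eq[OF M M a, of "\<lambda>x. x" e] by (auto simp: pid_def)

lemma pid_mopen:
  assumes M: "mt_rep M X e" and u: "mopen M u"
  shows "pid M u = u"
proof -
  interpret M: mt_rep M X e by (rule M)
  have "u \<in> mcar M" using u by (simp add: mopen_def)
  moreover have "(\<Union>(v, w)\<in>pairs_below M e u. e v - e w) = e u"
  proof -
    \<comment> \<open>An open element is the difference of itself and bottom, so this single pair
      already contributes all of \<open>e u\<close>.\<close>
    have "(u, mbot M) \<in> pairs_below M e u"
      using u by (auto simp: pairs_below_def M.mopen_iff M.bot_top)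
    then show ?thesis unfolding pairs_below_def using M.bot_top by fastforce
  qed
  ultimately show ?thesis using pid_rep[OF M, of u] M.eq_iff by metis
qed

section \<open>Proximity morphisms computed from their values on opens\<close>

lemma proximity_mcar: "proximity M N g \<Longrightarrow> a \<in> mcar M \<Longrightarrow> g a \<in> mcar N"
  unfolding proximity_def by (elim conjE) (rule bspec)

lemma proximity_mopen: "proximity M N g \<Longrightarrow> mopen M u \<Longrightarrow> mopen N (g u)"
  by (simp add: proximity_def)

lemma proximity_meet:
  "proximity M N g \<Longrightarrow> a \<in> mcar M \<Longrightarrow> b \<in> mcar M \<Longrightarrow> g (mmeet M a b) = mmeet N (g a) (g b)"
  by (simp add: proximity_def)

lemma proximity_msup_mopen:
  "proximity M N g \<Longrightarrow> S \<subseteq> {u. mopen M u} \<Longrightarrow> g (msup M S) = msup N (g ` S)"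
  by (simp add: proximity_def)

lemma proximity_msup_LC:
  "proximity M N g \<Longrightarrow> finite S \<Longrightarrow> S \<subseteq> LC M \<Longrightarrow> g (msup M S) = msup N (g ` S)"
  by (simp add: proximity_def)

lemma proximity_eq_msup:
  "proximity M N g \<Longrightarrow> a \<in> mcar M \<Longrightarrow> g a = msup N (g ` {x \<in> LC M. mle M x a})"
  by (simp add: proximity_def)

text \<open>The element \<open>c\<close> is the complement of \<open>v\<close> relative to
  \<open>u\<close> up to the part of \<open>v\<close> outside \<open>u\<close>: it lies below
  \<open>u\<close>, is disjoint from \<open>v\<close>, and \<open>u\<close> lies below the join of
  \<open>c\<close> and \<open>v\<close>. These relations survive \<open>g\<close> because
  \<open>c\<close> and \<open>v\<close> are locally closed, so (P3) applies to their join, while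
  (P2) handles the meets.\<close>

lemma proximity_diff:
  assumes M: "mt_rep M Y e" and N: "mt_rep N X d" and g: "proximity M N g"
    and c: "c \<in> mcar M" and u: "mopen M u" and v: "mopen M v" and eq: "e c = e u - e v"
  shows "g c \<in> mcar N" and "d (g c) = d (g u) - d (g v)"
proof -
  interpret M: mt_rep M Y e by (rule M)
  interpret N: mt_rep N X d by (rule N)
  note gN = proximity_mcar[OF g]
  note g_meet = proximity_meet[OF g]
  have uv: "u \<in> mcar M" "v \<in> mcar M" using u v by (auto simp: mopen_def)
  have cLC: "c \<in> LC M" using M.LC_iff c u v eq by blast
  \<comment> \<open>The empty instance of (P3) preserves bottom, which is what turns preserved meets
    into preserved disjointness.\<close>
  have "g (msup M {}) = msup N (g ` {})"
    by (rule proximity_msup_LC[OF g]) auto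
  then have bot: "g (mbot M) = mbot N" by (simp add: mbot_def)
  have "g (msup M {c, v}) = msup N (g ` {c, v})"
    by (rule proximity_msup_LC[OF g]) (use cLC M.mopen_LC[OF v] in auto)
  then have "g (mjoin M c v) = mjoin N (g c) (g v)" by (simp add: mjoin_def)
  then have 1: "d (g (mjoin M c v)) = d (g c) \<union> d (g v)" using N.join gN c uv by simp
  have "u = mmeet M u (mjoin M c v)"
    using M.eq_iff M.meet M.join c uv eq by auto
  then have "d (g u) = d (g u) \<inter> d (g (mjoin M c v))"
    using g_meet N.meet gN M.join c uv by metis
  moreover have "c = mmeet M c u"
    using M.eq_iff M.meet c uv eq by auto
  then have "d (g c) = d (g c) \<inter> d (g u)"
    using g_meet N.meet gN c uv by metis
  moreover have "mmeet M c v = mbot M"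
    using M.eq_iff M.meet M.bot_top c uv eq by auto
  then have "d (g c) \<inter> d (g v) = {}"
    using g_meet N.meet gN c uv bot N.bot_top by metis
  ultimately show "d (g c) = d (g u) - d (g v)" using 1 by blast
  show "g c \<in> mcar N" using gN c by blast
qed

lemma proximity_rep:
  assumes M: "mt_rep M Y e" and N: "mt_rep N X d" and g: "proximity M N g" and a: "a \<in> mcar M"
  shows "d (g a) = (\<Union>(u, v)\<in>pairs_below M e a. d (g u) - d (g v))"
proof -
  have "g a = msup N (g ` {x \<in> LC M. mle M x a})"
    by (rule proximity_eq_msup[OF g a])
  moreover have "d (msup N (g ` {x \<in> LC M. mle M x a})) =
      (\<Union>(u, v)\<in>pairs_below M e a. d (g u) - d (g v))"
    by (rule sup_LC_eq(2)[OF M N a, of g "\<lambda>u. d (g u)"]) (simp add: proximity_diff[OF M N g])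
  ultimately show ?thesis by simp
qed

text \<open>Since \<open>g\<close> sends opens to opens, \<open>proximity_diff\<close> can be
  applied first to \<open>g\<close> and then to \<open>h\<close>: a difference of opens is carried
  to a difference of opens at each stage.\<close>

lemma pcomp_rep:
  assumes M: "mt_rep M Y e" and N: "mt_rep N X d" and K: "mt_rep K Z c"
    and g: "proximity M N g" and h: "proximity N K h" and a: "a \<in> mcar M"
  shows "pcomp M K h g a \<in> mcar K"
    and "c (pcomp M K h g a) = (\<Union>(u, v)\<in>pairs_below M e a. c (h (g u)) - c (h (g v)))"
proof -
  have F: "h (g x) \<in> mcar K \<and> c (h (g x)) = c (h (g u)) - c (h (g v))"
    if "x \<in> mcar M" "mopen M u" "mopen M v" "e x = e u - e v" for x u v
    using proximity_diff[OF M N g that] that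
      proximity_diff[OF N K h, of "g x" "g u" "g v"] proximity_mopen[OF g] by blast
  show "pcomp M K h g a \<in> mcar K"
    and "c (pcomp M K h g a) = (\<Union>(u, v)\<in>pairs_below M e a. c (h (g u)) - c (h (g v)))"
    unfolding pcomp_def
    using sup_LC_eq[OF M K a, of "\<lambda>x. h (g x)" "\<lambda>u. c (h (g u))"] F by blast+
qed

text \<open>An open \<open>u\<close> is the greatest locally closed element below itself and
  \<open>h\<close> after \<open>g\<close> is monotone, so the supremum defining the composite is
  attained at \<open>u\<close>.\<close>

lemma pcomp_mopen:
  assumes M: "mt_rep M Y e" and N: "mt_rep N X d" and K: "mt_rep K Z c"
    and g: "proximity M N g" and h: "proximity N K h" and u: "mopen M u"
  shows "pcomp M K h g u = h (g u)"
proof -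
  interpret K: mt_rep K Z c by (rule K)
  interpret M: mt_rep M Y e by (rule M)
  have uM: "u \<in> mcar M" using u by (simp add: mopen_def)
  have comp: "h (g x) \<in> mcar K" if "x \<in> mcar M" for x
    using that proximity_mcar[OF g] proximity_mcar[OF h] by blast
  have *: "mopen N (g u)" "mopen N (g v)" if "mopen M v" for v
    using proximity_mopen[OF g] u that by auto
  have "c (h (g x)) \<subseteq> c (h (g u))" if "x \<in> LC M" "mle M x u" for x
  proof -
    have "mmeet M x u = x" using that M.LC_mcar uM M.meet M.eq_iff M.le_iff
      by (metis Int_absorb2)
    then have "h (g x) = mmeet K (h (g x)) (h (g u))"
      using that M.LC_mcar uM proximity_meet[OF g] proximity_meet[OF h] proximity_mcar[OF g] by metis
    then show ?thesis using K.meet comp that uM M.LC_mcar by (metis inf_le2)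
  qed
  then have "(\<Union>x\<in>{x \<in> LC M. mle M x u}. c (h (g x))) = c (h (g u))"
    using M.mopen_LC[OF u] M.le_iff[OF uM uM] by auto
  moreover have "(\<lambda>x. h (g x)) ` {x \<in> LC M. mle M x u} \<subseteq> mcar K"
    using comp M.LC_mcar by blast
  ultimately show ?thesis
    unfolding pcomp_def using K.msup[of "(\<lambda>x. h (g x)) ` {x \<in> LC M. mle M x u}"] comp[OF uM]
    by (subst K.eq_iff) simp_all
qed

section \<open>Sober maps\<close>

lemma openin_sob: "openin (sob X) S \<longleftrightarrow> (\<exists>U. openin X U \<and> S = {P. cpf X P \<and> U \<in> P})"
proof -
  have "istopology (\<lambda>S. \<exists>U. openin X U \<and> S = {P. cpf X P \<and> U \<in> P})"
    unfolding istopology_def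
  proof (intro conjI allI impI)
    fix S T assume "\<exists>U. openin X U \<and> S = {P. cpf X P \<and> U \<in> P}"
      "\<exists>U. openin X U \<and> T = {P. cpf X P \<and> U \<in> P}"
    then obtain U V where UV: "openin X U" "S = {P. cpf X P \<and> U \<in> P}"
      "openin X V" "T = {P. cpf X P \<and> V \<in> P}" by blast
    have "U \<inter> V \<in> P \<longleftrightarrow> U \<in> P \<and> V \<in> P" if "cpf X P" for P
      using that UV unfolding cpf_def by (meson inf_le1 inf_le2)
    then have "S \<inter> T = {P. cpf X P \<and> U \<inter> V \<in> P}" using UV by blast
    then show "\<exists>U. openin X U \<and> S \<inter> T = {P. cpf X P \<and> U \<in> P}" using UV by blast
  next
    fix \<K> assume K: "\<forall>S\<in>\<K>. \<exists>U. openin X U \<and> S = {P. cpf X P \<and> U \<in> P}"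
    \<comment> \<open>All opens whose basic set lies in the family; complete primeness identifies
      the union of these basic sets with the basic set of \<open>\<Union>\<U>\<close>.\<close>
    define \<U> where "\<U> = {U. openin X U \<and> {P. cpf X P \<and> U \<in> P} \<in> \<K>}"
    have op: "openin X (\<Union>\<U>)" unfolding \<U>_def by blast
    have "\<Union>\<U> \<in> P \<longleftrightarrow> (\<exists>U\<in>\<U>. U \<in> P)" if P: "cpf X P" for P
    proof
      assume "\<Union>\<U> \<in> P"
      moreover have "\<U> \<subseteq> {U. openin X U}" unfolding \<U>_def by blast
      ultimately show "\<exists>U\<in>\<U>. U \<in> P" using P unfolding cpf_def by blast
    next
      assume "\<exists>U\<in>\<U>. U \<in> P"
      then show "\<Union>\<U> \<in> P" using P op unfolding cpf_def by (meson Union_upper)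
    qed
    then have "\<Union>\<K> = {P. cpf X P \<and> \<Union>\<U> \<in> P}"
      unfolding \<U>_def using K by fastforce
    then show "\<exists>U. openin X U \<and> \<Union>\<K> = {P. cpf X P \<and> U \<in> P}" using op by blast
  qed
  then show ?thesis by (simp add: sob_def topology_inverse')
qed

lemma topspace_sob: "topspace (sob X) = {P. cpf X P}"
proof -
  have "openin (sob X) {P. cpf X P}"
    unfolding openin_sob cpf_def by (intro exI[of _ "topspace X"]) auto
  moreover have "topspace (sob X) \<subseteq> {P. cpf X P}"
    using openin_topspace[of "sob X"] unfolding openin_sob by blast
  ultimately show ?thesis using openin_subset by blast
qed

lemma cpf_openin: "cpf X P \<Longrightarrow> U \<in> P \<Longrightarrow> openin X U"
  unfolding cpf_def by blast

lemma cpf_mono: "cpf X P \<Longrightarrow> U \<in> P \<Longrightarrow> openin X V \<Longrightarrow> U \<subseteq> V \<Longrightarrow> V \<in> P"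
  unfolding cpf_def by blast

lemma cpf_Int: "cpf X P \<Longrightarrow> U \<in> P \<Longrightarrow> V \<in> P \<Longrightarrow> U \<inter> V \<in> P"
  unfolding cpf_def by blast

lemma cpf_Int_iff:
  "cpf X P \<Longrightarrow> openin X U \<Longrightarrow> openin X V \<Longrightarrow> U \<inter> V \<in> P \<longleftrightarrow> U \<in> P \<and> V \<in> P"
  by (meson cpf_Int cpf_mono inf_le1 inf_le2)

lemma cpf_Union_iff:
  assumes "cpf X P" "S \<subseteq> {U. openin X U}"
  shows "\<Union>S \<in> P \<longleftrightarrow> (\<exists>U\<in>S. U \<in> P)"
proof
  assume "\<Union>S \<in> P" then show "\<exists>U\<in>S. U \<in> P" using assms unfolding cpf_def by blast
next
  assume "\<exists>U\<in>S. U \<in> P"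
  moreover have "openin X (\<Union>S)" using assms by blast
  ultimately show "\<Union>S \<in> P" using cpf_mono[OF assms(1)] by blast
qed

text \<open>Complete primeness applied to the empty family; this is how filters turn out to be
  proper.\<close>

lemma cpf_empty: "cpf X P \<Longrightarrow> {} \<notin> P"
  using cpf_Union_iff[of X P "{}"] by simp

lemma cpf_Un_iff:
  "cpf X P \<Longrightarrow> openin X U \<Longrightarrow> openin X V \<Longrightarrow> U \<union> V \<in> P \<longleftrightarrow> U \<in> P \<or> V \<in> P"
  using cpf_Union_iff[of X P "{U, V}"] by simp

lemma sober_map_iff:
  "sober_map X Y f \<longleftrightarrow> (\<forall>x\<in>topspace X. cpf Y (f x)) \<and>
     (\<forall>U. openin Y U \<longrightarrow> openin X {x \<in> topspace X. U \<in> f x})"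
proof -
  have eq: "{x \<in> topspace X. f x \<in> {P. cpf Y P \<and> U \<in> P}} = {x \<in> topspace X. U \<in> f x}"
    if "\<forall>x\<in>topspace X. cpf Y (f x)" for U using that by blast
  have "(\<forall>S. openin (sob Y) S \<longrightarrow> openin X {x \<in> topspace X. f x \<in> S}) \<longleftrightarrow>
      (\<forall>U. openin Y U \<longrightarrow> openin X {x \<in> topspace X. f x \<in> {P. cpf Y P \<and> U \<in> P}})"
    unfolding openin_sob by blast
  then show ?thesis
    unfolding sober_map_def continuous_map_def topspace_sob
    using eq by (simp add: Pi_iff cong: conj_cong)
qed

lemma sober_map_cpf: "sober_map X Y f \<Longrightarrow> x \<in> topspace X \<Longrightarrow> cpf Y (f x)"
  by (simp add: sober_map_iff)

lemma sober_map_openin: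
  "sober_map X Y f \<Longrightarrow> openin Y U \<Longrightarrow> openin X {x \<in> topspace X. U \<in> f x}"
  by (simp add: sober_map_iff)

lemma cpf_lam: "x \<in> topspace X \<Longrightarrow> cpf X (lam X x)"
  unfolding cpf_def lam_def by (auto intro: openin_Union)

text \<open>Ordinary continuous maps are sober maps through \<open>lam Y\<close>. The identity and
  both directions of the unit isomorphism arise in this way.\<close>

lemma sober_map_lam_comp:
  assumes "continuous_map X Y f"
  shows "sober_map X Y (\<lambda>x. lam Y (f x))"
  unfolding sober_map_iff
proof (intro conjI ballI allI impI)
  fix x assume "x \<in> topspace X"
  then show "cpf Y (lam Y (f x))" using assms by (auto simp: cpf_lam continuous_map_def Pi_iff)
next
  fix U assume "openin Y U"
  then show "openin X {x \<in> topspace X. U \<in> lam Y (f x)}"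
    using assms by (simp add: lam_def continuous_map)
qed

lemma sober_map_lam: "sober_map X X (lam X)"
  using sober_map_lam_comp[of X X id] by simp

lemma inv_lam_sob:
  assumes "cpf Z Q"
  shows "inv_into (topspace (sob Z)) (lam (sob Z)) (lam (sob Z) Q) = Q"
proof (rule inv_into_f_f)
  \<comment> \<open>A point of \<open>sob Z\<close> is recovered from its neighbourhood filter by
    testing the basic opens, which gives a left inverse of \<open>lam (sob Z)\<close> and hence its
    injectivity.\<close>
  have *: "{U. openin Z U \<and> {R. cpf Z R \<and> U \<in> R} \<in> lam (sob Z) P} = P"
    if "cpf Z P" for P
    using that cpf_openin[OF that] by (auto simp: lam_def openin_sob)
  show "inj_on (lam (sob Z)) (topspace (sob Z))"
    by (rule inj_on_inverseI[where g = "\<lambda>\<Q>. {U. openin Z U \<and> {R. cpf Z R \<and> U \<in> R} \<in> \<Q>}"])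
      (simp add: * topspace_sob)
qed (use assms topspace_sob in auto)

text \<open>Pulling opens back along a sober map is a frame morphism, called \<open>G\<close> in the
  proof, and the inverse image of a completely prime filter under a frame morphism is again
  one.\<close>

lemma scomp_cpf:
  assumes P: "cpf Y P" and g: "sober_map Y Z g"
  shows "cpf Z {U. openin Z U \<and> {y \<in> topspace Y. U \<in> g y} \<in> P}"
proof -
  define G where "G U = {y \<in> topspace Y. U \<in> g y}" for U
  have G: "openin Y (G U)" if "openin Z U" for U
    unfolding G_def by (rule sober_map_openin[OF g that])
  note cpf = sober_map_cpf[OF g]
  have G_Int: "G (U \<inter> V) = G U \<inter> G V" if "openin Z U" "openin Z V" for U V
    unfolding G_def using cpf_Int_iff[OF cpf] that by auto
  have G_mono: "G U \<subseteq> G V" if "openin Z V" "U \<subseteq> V" for U V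
    unfolding G_def using cpf_mono[OF cpf] that by auto
  have G_Union: "G (\<Union>S) = \<Union>(G ` S)" if "S \<subseteq> {U. openin Z U}" for S
    unfolding G_def using cpf_Union_iff[OF cpf that] by auto
  have G_top: "G (topspace Z) = topspace Y"
    unfolding G_def using cpf by (auto simp: cpf_def)
  have "\<exists>U\<in>S. openin Z U \<and> G U \<in> P" if "S \<subseteq> {U. openin Z U}" "G (\<Union>S) \<in> P" for S
  proof -
    have "\<Union>(G ` S) \<in> P" "G ` S \<subseteq> {U. openin Y U}" using that G G_Union by auto
    then show ?thesis using cpf_Union_iff[OF P, of "G ` S"] that by blast
  qed
  moreover have "topspace Y \<in> P" using P by (simp add: cpf_def)
  moreover have "G V \<in> P" if "G U \<in> P" "openin Z V" "U \<subseteq> V" for U V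
    using cpf_mono[OF P that(1) G[OF that(2)] G_mono[OF that(2,3)]] .
  moreover have "G (U \<inter> V) \<in> P" if "openin Z U" "openin Z V" "G U \<in> P" "G V \<in> P" for U V
    using cpf_Int[OF P that(3,4)] G_Int[OF that(1,2)] by simp
  ultimately have "cpf Z {U. openin Z U \<and> G U \<in> P}"
    unfolding cpf_def using G_top by auto
  then show ?thesis by (simp add: G_def)
qed

text \<open>Removes the inverse of \<open>lam (sob Z)\<close> from the composite: the filter
  \<open>smap Y (sob Z) g (f x)\<close> is the neighbourhood filter of an explicit point
  \<open>Q\<close> of \<open>sob Z\<close>.\<close>

lemma scomp_eq:
  assumes fx: "cpf Y (f x)" and g: "sober_map Y Z g"
  shows "scomp Y Z g f x = {U. openin Z U \<and> {y \<in> topspace Y. U \<in> g y} \<in> f x}"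
proof -
  define Q where "Q = {U. openin Z U \<and> {y \<in> topspace Y. U \<in> g y} \<in> f x}"
  have Q: "cpf Z Q" unfolding Q_def by (rule scomp_cpf[OF fx g])
  have eq: "{y \<in> topspace Y. g y \<in> {P. cpf Z P \<and> U \<in> P}} = {y \<in> topspace Y. U \<in> g y}" for U
    using sober_map_cpf[OF g] by blast
  have "smap Y (sob Z) g (f x) = lam (sob Z) Q"
    unfolding smap_def lam_def openin_sob using Q eq by (auto simp: Q_def)
  then show ?thesis unfolding scomp_def using inv_lam_sob[OF Q] Q_def by simp
qed

text \<open>Composing after a sober map that comes from an ordinary function is ordinary
  composition, because a pulled back open belongs to the neighbourhood filter of \<open>g x\<close>
  exactly when it contains \<open>g x\<close>.\<close>

lemma scomp_lam:
  assumes "g \<in> topspace X \<rightarrow> topspace Y" "x \<in> topspace X" "sober_map Y Z h"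
  shows "scomp Y Z h (\<lambda>x. lam Y (g x)) x = h (g x)"
proof -
  have gx: "g x \<in> topspace Y" using assms by blast
  then have "scomp Y Z h (\<lambda>x. lam Y (g x)) x =
      {U. openin Z U \<and> {y \<in> topspace Y. U \<in> h y} \<in> lam Y (g x)}"
    by (intro scomp_eq cpf_lam gx assms(3))
  also have "\<dots> = h (g x)"
    using gx sober_map_openin[OF assms(3)] cpf_openin[OF sober_map_cpf[OF assms(3) gx]]
    unfolding lam_def by blast
  finally show ?thesis .
qed

lemma sober_map_scomp:
  assumes f: "sober_map X Y f" and g: "sober_map Y Z g"
  shows "sober_map X Z (scomp Y Z g f)"
proof -
  note fx = sober_map_cpf[OF f]
  have eq: "scomp Y Z g f x = {U. openin Z U \<and> {y \<in> topspace Y. U \<in> g y} \<in> f x}"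
    if "x \<in> topspace X" for x by (rule scomp_eq[where f = f, OF fx[OF that] g])
  have "openin X {x \<in> topspace X. U \<in> scomp Y Z g f x}" if U: "openin Z U" for U
  proof -
    have "{x \<in> topspace X. U \<in> scomp Y Z g f x} =
        {x \<in> topspace X. {y \<in> topspace Y. U \<in> g y} \<in> f x}"
      using eq U by auto
    then show ?thesis using sober_map_openin[OF f sober_map_openin[OF g U]] by simp
  qed
  then show ?thesis
    unfolding sober_map_iff using eq scomp_cpf[OF fx g] by simp
qed

section \<open>Extending sober maps to proximity morphisms\<close>

text \<open>For \<open>P = lam Y y\<close> with \<open>y\<close> in the space this says that
  \<open>A\<close> contains a locally closed set through \<open>y\<close>. Phrasing it by the filter
  makes it meaningful at every point of \<open>sob Y\<close>.\<close>

definition lc_mem :: "'a topology \<Rightarrow> 'a set set \<Rightarrow> 'a set \<Rightarrow> bool" where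
  "lc_mem Y P A \<longleftrightarrow> (\<exists>U V. U \<in> P \<and> openin Y V \<and> V \<notin> P \<and> U - V \<subseteq> A)"

text \<open>A witness gives \<open>U \<subseteq> V \<union> W\<close>, and primeness with
  \<open>V \<notin> P\<close> leaves \<open>W \<in> P\<close>. Conversely \<open>V = {}\<close>
  serves, since the filter is proper.\<close>

lemma lc_mem_openin:
  assumes P: "cpf Y P" and W: "openin Y W"
  shows "lc_mem Y P W \<longleftrightarrow> W \<in> P"
proof
  assume "lc_mem Y P W"
  then obtain U V where UV: "U \<in> P" "openin Y V" "V \<notin> P" "U \<subseteq> V \<union> W"
    unfolding lc_mem_def by blast
  then have "V \<union> W \<in> P" using cpf_mono[OF P, of U "V \<union> W"] W by blast
  then show "W \<in> P" using cpf_Un_iff[OF P] UV W by blast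
next
  assume "W \<in> P"
  then show "lc_mem Y P W"
    unfolding lc_mem_def using cpf_empty[OF P] by (intro exI[of _ W] exI[of _ "{}"]) simp
qed

lemma lc_mem_mono: "lc_mem Y P A \<Longrightarrow> A \<subseteq> B \<Longrightarrow> lc_mem Y P B"
  unfolding lc_mem_def by blast

lemma lc_mem_Int:
  assumes P: "cpf Y P"
  shows "lc_mem Y P (A \<inter> B) \<longleftrightarrow> lc_mem Y P A \<and> lc_mem Y P B"
proof
  assume "lc_mem Y P A \<and> lc_mem Y P B"
  then obtain U V U' V' where *: "U \<in> P" "openin Y V" "V \<notin> P" "U - V \<subseteq> A"
    "U' \<in> P" "openin Y V'" "V' \<notin> P" "U' - V' \<subseteq> B" unfolding lc_mem_def by blast
  \<comment> \<open>Locally closed sets are closed under intersection: intersect the positive parts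
    and unite the removed ones, where primeness keeps the union out of \<open>P\<close>.\<close>
  then have "U \<inter> U' \<in> P" "openin Y (V \<union> V')" "V \<union> V' \<notin> P" "U \<inter> U' - (V \<union> V') \<subseteq> A \<inter> B"
    using cpf_Int[OF P] cpf_Un_iff[OF P, of V V'] by blast+
  then show "lc_mem Y P (A \<inter> B)" unfolding lc_mem_def by blast
qed (auto elim: lc_mem_mono)

lemma lc_mem_diff:
  assumes "U \<in> P" "openin Y V" "V \<notin> P" shows "lc_mem Y P (U - V)"
  unfolding lc_mem_def using assms by blast

text \<open>If the point given by \<open>P\<close> lies outside \<open>U - V\<close>, then the
  witness \<open>U' - V'\<close> can be shrunk to avoid \<open>U - V\<close> altogether, and what is
  left lies in \<open>A\<close>.\<close>

lemma lc_mem_Un_lc: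
  assumes P: "cpf Y P" and UV: "openin Y U" "openin Y V" and m: "lc_mem Y P (A \<union> (U - V))"
  shows "lc_mem Y P A \<or> lc_mem Y P (U - V)"
proof (cases "U \<in> P \<and> V \<notin> P")
  case True
  then show ?thesis using lc_mem_diff[of U P Y V] UV by blast
next
  case False
  obtain U' V' where *: "U' \<in> P" "openin Y V'" "V' \<notin> P" "U' - V' \<subseteq> A \<union> (U - V)"
    using m unfolding lc_mem_def by blast
  show ?thesis
  proof (cases "U \<in> P")
    case True
    \<comment> \<open>Here \<open>V \<in> P\<close>, so the witness may be restricted to
      \<open>V\<close>, which misses \<open>U - V\<close>.\<close>
    then have "U' \<inter> V \<in> P" using False cpf_Int[OF P, of U' V] * UV by blast
    moreover have "U' \<inter> V - V' \<subseteq> A" using * by blast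
    ultimately show ?thesis unfolding lc_mem_def using * by blast
  next
    case False
    \<comment> \<open>Here \<open>U \<notin> P\<close>, so all of \<open>U\<close> may be removed
      from the witness without losing the point.\<close>
    then have "V' \<union> U \<notin> P" using cpf_Un_iff[OF P, of V' U] * UV by blast
    moreover have "U' - (V' \<union> U) \<subseteq> A" "openin Y (V' \<union> U)" using * UV by blast+
    ultimately show ?thesis unfolding lc_mem_def using * by blast
  qed
qed

lemma lc_mem_Union_lc:
  assumes P: "cpf Y P" and "finite \<C>"
    and "\<forall>C\<in>\<C>. \<exists>U V. openin Y U \<and> openin Y V \<and> C = U - V"
  shows "lc_mem Y P (\<Union>\<C>) \<longleftrightarrow> (\<exists>C\<in>\<C>. lc_mem Y P C)"
  using assms(2,3)
proof (induction \<C> rule: finite_induct)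
  case empty
  then show ?case using lc_mem_openin[OF P openin_empty] cpf_empty[OF P] by simp
next
  case (insert C \<C>)
  obtain U V where C: "openin Y U" "openin Y V" "C = U - V" using insert.prems by blast
  have "lc_mem Y P (\<Union>(insert C \<C>)) \<longleftrightarrow> lc_mem Y P (\<Union>\<C>) \<or> lc_mem Y P C"
  proof
    assume "lc_mem Y P (\<Union>(insert C \<C>))"
    then have "lc_mem Y P (\<Union>\<C> \<union> (U - V))" using C by (simp add: Un_commute)
    then show "lc_mem Y P (\<Union>\<C>) \<or> lc_mem Y P C" using lc_mem_Un_lc[OF P C(1,2)] C by blast
  qed (auto elim: lc_mem_mono)
  then show ?case using insert by auto
qed

text \<open>Meets come from \<open>lc_mem_Int\<close>, arbitrary joins of opens from complete
  primeness, and finite joins of locally closed elements from \<open>lc_mem_Union_lc\<close>. (P4)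
  is built into \<open>lc_mem\<close>, whose witness \<open>U - V\<close> is itself locally
  closed.\<close>

lemma ex_proximity:
  assumes M: "mt_rep M Y e" and N: "mt_rep N X d" and f: "sober_map X Y f"
  shows "\<exists>h. proximity M N h \<and> (\<forall>u. mopen M u \<longrightarrow> d (h u) = {x \<in> topspace X. e u \<in> f x})"
proof -
  interpret M: mt_rep M Y e by (rule M)
  interpret N: mt_rep N X d by (rule N)
  define H where "H A = {x \<in> topspace X. lc_mem Y (f x) A}" for A
  \<comment> \<open>\<open>H\<close> takes values inside \<open>topspace X\<close> for every
    argument, so representatives in \<open>N\<close> can be chosen for all \<open>a\<close> of the
    type at once.\<close>
  have "\<exists>h. \<forall>a. h a \<in> mcar N \<and> d (h a) = H (e a)"
  proof (intro choice allI)
    fix a show "\<exists>b. b \<in> mcar N \<and> d b = H (e a)"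
      using N.obtain_rep[of "H (e a)"] unfolding H_def by blast
  qed
  then obtain h where h: "\<And>a. h a \<in> mcar N" "\<And>a. d (h a) = H (e a)" by blast
  note cpf = sober_map_cpf[OF f]
  have H_open: "H U = {x \<in> topspace X. U \<in> f x}" if "openin Y U" for U
    unfolding H_def using lc_mem_openin[OF cpf that] by blast
  have H_Int: "H (A \<inter> B) = H A \<inter> H B" for A B
    unfolding H_def using lc_mem_Int[OF cpf] by blast
  \<comment> \<open>Both kinds of join preservation thereby reduce to \<open>H\<close> commuting
    with the union in question.\<close>
  have h_msup: "h (msup M S) = msup N (h ` S)"
    if "S \<subseteq> mcar M" "H (\<Union>(e ` S)) = (\<Union>s\<in>S. H (e s))" for S
    using that N.msup[of "h ` S"] M.msup[of S] h
      N.eq_iff[of "h (msup M S)" "msup N (h ` S)"] by (simp add: image_subset_iff)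
  have "proximity M N h"
    unfolding proximity_def
  proof (intro conjI ballI allI impI)
    show "mt_algebra M" "mt_algebra N" by (rule M.mt_algebra, rule N.mt_algebra)
    show "h a \<in> mcar N" for a by (rule h)
    show "mopen N (h u)" if "mopen M u" for u
      using that h H_open sober_map_openin[OF f] by (simp add: M.mopen_iff N.mopen_iff)
    have "{x \<in> topspace X. topspace Y \<in> f x} = topspace X" using cpf cpf_def by blast
    then show "h (mtop M) = mtop N"
      using h H_open[of "topspace Y"] M.bot_top N.bot_top N.eq_iff[of "h (mtop M)" "mtop N"] by simp
    show "h (msup M S) = msup N (h ` S)" if S: "S \<subseteq> {u. mopen M u}" for S
    proof (rule h_msup)
      show "S \<subseteq> mcar M" using S M.mopen_iff by blast
      have op: "openin Y (e s)" if "s \<in> S" for s using that S M.mopen_iff by blast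
      then have "openin Y (\<Union>(e ` S))" "e ` S \<subseteq> {U. openin Y U}" by blast+
      then show "H (\<Union>(e ` S)) = (\<Union>s\<in>S. H (e s))"
        using H_open op cpf_Union_iff[OF cpf, of _ "e ` S"] by auto
    qed
    show "h (mmeet M a b) = mmeet N (h a) (h b)" if "a \<in> mcar M" "b \<in> mcar M" for a b
      using that h H_Int M.meet N.meet N.eq_iff[of "h (mmeet M a b)" "mmeet N (h a) (h b)"] by simp
    show "h (msup M S) = msup N (h ` S)" if S: "finite S \<and> S \<subseteq> LC M" for S
    proof (rule h_msup)
      show "S \<subseteq> mcar M" using S M.LC_mcar by blast
      have "\<forall>C\<in>e ` S. \<exists>U V. openin Y U \<and> openin Y V \<and> C = U - V"
        using S unfolding M.LC_iff M.mopen_iff subset_iff by blast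
      then show "H (\<Union>(e ` S)) = (\<Union>s\<in>S. H (e s))"
        unfolding H_def using lc_mem_Union_lc[OF cpf, of _ "e ` S"] S by auto
    qed
    show "h a = msup N (h ` {x \<in> LC M. mle M x a})" if a: "a \<in> mcar M" for a
    proof -
      have "H (e a) = (\<Union>x\<in>{x \<in> LC M. mle M x a}. H (e x))" (is "_ = ?R")
      proof
        show "?R \<subseteq> H (e a)"
          using M.le_iff[OF M.LC_mcar a] lc_mem_mono unfolding H_def by blast
        show "H (e a) \<subseteq> ?R"
        proof
          fix x assume "x \<in> H (e a)"
          then obtain U V where UV: "x \<in> topspace X" "U \<in> f x" "openin Y V" "V \<notin> f x"
            "U - V \<subseteq> e a" unfolding H_def lc_mem_def by blast
          have U: "openin Y U" using UV cpf cpf_openin by blast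
          obtain u v where uv: "mopen M u" "e u = U" "mopen M v" "e v = V"
            using M.obtain_mopen U UV by metis
          have "U - V \<subseteq> topspace Y" using openin_subset[OF U] by blast
          then obtain c where c: "c \<in> mcar M" "e c = U - V" using M.obtain_rep by blast
          have "c \<in> LC M" "mle M c a" using c uv UV a M.LC_iff M.le_iff by auto
          moreover have "x \<in> H (e c)" using c UV lc_mem_diff unfolding H_def by force
          ultimately show "x \<in> ?R" by blast
        qed
      qed
      moreover have "h ` {x \<in> LC M. mle M x a} \<subseteq> mcar N" using h by blast
      ultimately show ?thesis
        using N.msup[of "h ` {x \<in> LC M. mle M x a}"] h
          N.eq_iff[of "h a" "msup N (h ` {x \<in> LC M. mle M x a})"] by simp
    qed
  qed
  moreover have "d (h u) = {x \<in> topspace X. e u \<in> f x}" if "mopen M u" for u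
    using that h H_open M.mopen_iff by simp
  ultimately show ?thesis by blast
qed

text \<open>\<open>prox_det\<close> is a choice, so a single proximity morphism agreeing with
  \<open>\<phi>\<close> on opens suffices. The extension of \<open>f\<close> is one, because
  \<open>d\<close> is injective on \<open>mcar N\<close>.\<close>

lemma prox_det_proximity:
  assumes M: "mt_rep M Y e" and N: "mt_rep N X d" and f: "sober_map X Y f"
    and \<phi>: "\<And>u. mopen M u \<Longrightarrow> \<phi> u \<in> mcar N \<and> d (\<phi> u) = {x \<in> topspace X. e u \<in> f x}"
  shows "proximity M N (prox_det M N \<phi>)"
    and "mopen M u \<Longrightarrow> prox_det M N \<phi> u = \<phi> u"
proof -
  obtain h where h: "proximity M N h"
    and h_open: "\<And>u. mopen M u \<Longrightarrow> d (h u) = {x \<in> topspace X. e u \<in> f x}"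
    using ex_proximity[OF M N f] by blast
  have "h u = \<phi> u" if "mopen M u" for u
  proof -
    have "h u \<in> mcar N" using proximity_mcar[OF h] that by (simp add: mopen_def)
    then show ?thesis using mt_rep.eq_iff[OF N] \<phi>[OF that] h_open[OF that] by simp
  qed
  then have "proximity M N (prox_det M N \<phi>) \<and> (\<forall>u. mopen M u \<longrightarrow> prox_det M N \<phi> u = \<phi> u)"
    unfolding prox_det_def
    using someI[of "\<lambda>h. proximity M N h \<and> (\<forall>u. mopen M u \<longrightarrow> h u = \<phi> u)" h] h by blast
  then show "proximity M N (prox_det M N \<phi>)" "mopen M u \<Longrightarrow> prox_det M N \<phi> u = \<phi> u"
    by simp_all
qed

text \<open>Closes the equations between proximity morphisms: once both sides are unions of
  differences over the same pairs, agreement on opens is enough.\<close>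

lemma pairs_below_cong:
  assumes "\<And>u. mopen M u \<Longrightarrow> G u = H u"
  shows "(\<Union>(u, v)\<in>pairs_below M e a. G u - G v) = (\<Union>(u, v)\<in>pairs_below M e a. H u - H v)"
  using assms by (intro SUP_cong refl) (auto simp: pairs_below_def)

section \<open>Sober maps induced by proximity morphisms\<close>

lemma proximity_mono:
  assumes M: "mt_rep M Y e" and N: "mt_rep N X d" and g: "proximity M N g"
    and ab: "a \<in> mcar M" "b \<in> mcar M" "e a \<subseteq> e b"
  shows "d (g a) \<subseteq> d (g b)"
proof -
  have "mmeet M a b = a"
    using ab mt_rep.meet[OF M] mt_rep.eq_iff[OF M] by (metis inf.absorb1)
  then have "d (g a) = d (mmeet N (g a) (g b))" using proximity_meet[OF g] ab by metis
  then show ?thesis using mt_rep.meet[OF N] proximity_mcar[OF g] ab by blast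
qed

text \<open>\<open>e\<close> is injective, so an open set in the family comes from exactly one open
  element and no other element can put \<open>e u\<close> there.\<close>

lemma mem_opens_iff:
  assumes M: "mt_rep M Y e" and u: "mopen M u"
  shows "e u \<in> {e u | u. mopen M u \<and> Q u} \<longleftrightarrow> Q u"
proof -
  have "v = u" if "mopen M v" "e u = e v" for v
    using that u mt_rep.eq_iff[OF M, of v u] by (simp add: mopen_def)
  then show ?thesis using u by blast
qed

text \<open>By (P1) and (P2), \<open>g\<close> is a frame morphism on opens; the filter at
  \<open>x\<close> is the inverse image under it of the opens of \<open>N\<close> containing
  \<open>x\<close>. The set of \<open>x\<close> whose filter contains \<open>e u\<close> is
  \<open>d (g u)\<close>, which is open.\<close>

lemma sober_map_of_proximity:
  assumes M: "mt_rep M Y e" and N: "mt_rep N X d" and g: "proximity M N g"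
  shows "sober_map X Y (\<lambda>x. {e u | u. mopen M u \<and> x \<in> d (g u)})"
proof -
  interpret M: mt_rep M Y e by (rule M)
  interpret N: mt_rep N X d by (rule N)
  define f where "f x = {e u | u. mopen M u \<and> x \<in> d (g u)}" for x
  have mem: "e u \<in> f x \<longleftrightarrow> x \<in> d (g u)" if "mopen M u" for u x
    unfolding f_def by (rule mem_opens_iff[OF M that])
  have car: "g u \<in> mcar N" "u \<in> mcar M" if "mopen M u" for u
    using that proximity_mcar[OF g] by (auto simp: mopen_def)
  have "cpf Y (f x)" if x: "x \<in> topspace X" for x
    unfolding cpf_def
  proof (intro conjI allI impI)
    show "f x \<subseteq> {U. openin Y U}" unfolding f_def using M.mopen_iff by blast
    have "mopen M (mtop M)" using M.bot_top M.mopen_iff by simp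
    moreover have "g (mtop M) = mtop N" using g by (simp add: proximity_def)
    ultimately show "topspace Y \<in> f x" using mem[of "mtop M" x] M.bot_top N.bot_top x by simp
    show "V \<in> f x" if UV: "U \<in> f x \<and> openin Y V \<and> U \<subseteq> V" for U V
    proof -
      obtain u where "mopen M u" "e u = U" using UV unfolding f_def by blast
      moreover obtain v where "mopen M v" "e v = V" using UV M.obtain_mopen[of V] by blast
      ultimately show ?thesis
        using UV mem[of u x] mem[of v x] car proximity_mono[OF M N g, of u v] by blast
    qed
    show "U \<inter> V \<in> f x" if UV: "U \<in> f x \<and> V \<in> f x" for U V
    proof -
      obtain u v where uv: "mopen M u" "e u = U" "mopen M v" "e v = V"
        "x \<in> d (g u)" "x \<in> d (g v)"
        using UV unfolding f_def by blast
      have "e (mmeet M u v) = U \<inter> V" using uv car M.meet by simp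
      moreover have "mopen M (mmeet M u v)" using uv car M.meet M.mopen_iff by auto
      moreover have "x \<in> d (g (mmeet M u v))"
        using uv car proximity_meet[OF g] N.meet by simp
      ultimately show ?thesis using mem by metis
    qed
    show "\<exists>U\<in>S. U \<in> f x" if S: "S \<subseteq> {U. openin Y U} \<and> \<Union>S \<in> f x" for S
    proof -
      \<comment> \<open>Translates the family of open sets into open elements, so that preservation
        of arbitrary joins of opens by \<open>g\<close> can be used.\<close>
      define T where "T = {u. mopen M u \<and> e u \<in> S}"
      have T: "T \<subseteq> {u. mopen M u}" unfolding T_def by blast
      then have Tc: "T \<subseteq> mcar M" "g ` T \<subseteq> mcar N" using car by blast+
      have "S = e ` T"
      proof
        show "S \<subseteq> e ` T"
        proof
          fix U assume "U \<in> S"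
          moreover obtain u where "mopen M u" "e u = U" using M.obtain_mopen S \<open>U \<in> S\<close> by blast
          ultimately show "U \<in> e ` T" unfolding T_def by blast
        qed
      qed (auto simp: T_def)
      then have eT: "e (msup M T) = \<Union>S" using M.msup[OF Tc(1)] by simp
      moreover have "openin Y (\<Union>S)" using S by blast
      ultimately have "mopen M (msup M T)" using M.msup[OF Tc(1)] M.mopen_iff by simp
      then have "x \<in> d (g (msup M T))" using mem eT S by metis
      then have "x \<in> \<Union>(d ` g ` T)"
        using proximity_msup_mopen[OF g T] N.msup[OF Tc(2)] by simp
      then obtain t where "t \<in> T" "x \<in> d (g t)" by blast
      then show ?thesis using mem[of t x] unfolding T_def by blast
    qed
  qed
  moreover have "openin X {x \<in> topspace X. U \<in> f x}" if U: "openin Y U" for U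
  proof -
    obtain u where u: "mopen M u" "e u = U" using M.obtain_mopen U by blast
    then have "{x \<in> topspace X. U \<in> f x} = d (g u)"
      using mem[OF u(1)] N.e_subset[OF car(1)[OF u(1)]] by blast
    then show ?thesis using proximity_mopen[OF g u(1)] N.mopen_iff by simp
  qed
  ultimately show ?thesis unfolding f_def sober_map_iff by blast
qed

section \<open>Powersets and spatial algebras\<close>

lemma mt_rep_powalg: "mt_rep (powalg X) X (\<lambda>A. A)"
  by unfold_locales
    (auto simp: powalg_def bij_betw_def dest: subsetD[OF interior_of_subset_topspace])

lemma mcar_powalg: "mcar (powalg X) = Pow (topspace X)"
  by (simp add: powalg_def)

lemma mopen_powalg: "mopen (powalg X) U \<longleftrightarrow> openin X U"
  using mt_rep.mopen_iff[OF mt_rep_powalg, of X U] openin_subset by (auto simp: mcar_powalg)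

lemma atom_powalg: "atom (powalg X) A \<longleftrightarrow> (\<exists>x\<in>topspace X. A = {x})"
proof -
  have "mbot (powalg X) = {}" by (rule mt_rep.bot_top(2)[OF mt_rep_powalg])
  then have *: "atom (powalg X) A \<longleftrightarrow> A \<subseteq> topspace X \<and> A \<noteq> {} \<and> (\<forall>B\<subseteq>topspace X. B \<subseteq> A \<longrightarrow> B = {} \<or> B = A)"
    unfolding atom_def by (auto simp: powalg_def)
  show ?thesis
  proof
    assume A: "atom (powalg X) A"
    then obtain x where "x \<in> A" using * by blast
    moreover from this have "{x} = A" using A * by blast
    ultimately show "\<exists>x\<in>topspace X. A = {x}" using A * by blast
  qed (auto simp: *)
qed

lemma eta_powalg: "A \<subseteq> topspace X \<Longrightarrow> eta (powalg X) A = (\<lambda>x. {x}) ` A"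
  unfolding eta_def atom_powalg by (auto simp: powalg_def)

lemma spatial_powalg: "spatial_mt (powalg X)"
  unfolding spatial_mt_def
proof
  show "mt_algebra (powalg X)" by (rule mt_rep.mt_algebra[OF mt_rep_powalg])
  show "inj_on (eta (powalg X)) (mcar (powalg X))"
    by (rule inj_onI) (auto simp: mcar_powalg eta_powalg inj_image_eq_iff)
qed

section \<open>Representing a spatial algebra on its atoms\<close>

locale spatial =
  fixes M :: "'m mtalg"
  assumes spatial: "spatial_mt M"
begin

lemma mt: "mt_algebra M"
  using spatial by (simp add: spatial_mt_def)

lemma refl: "a \<in> mcar M \<Longrightarrow> mle M a a"
  and antisym: "a \<in> mcar M \<Longrightarrow> b \<in> mcar M \<Longrightarrow> mle M a b \<Longrightarrow> mle M b a \<Longrightarrow> a = b"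
  and trans: "a \<in> mcar M \<Longrightarrow> b \<in> mcar M \<Longrightarrow> c \<in> mcar M \<Longrightarrow> mle M a b \<Longrightarrow> mle M b c \<Longrightarrow> mle M a c"
  and ex_lub: "S \<subseteq> mcar M \<Longrightarrow> \<exists>a. is_lub M S a"
  and distrib: "a \<in> mcar M \<Longrightarrow> b \<in> mcar M \<Longrightarrow> c \<in> mcar M \<Longrightarrow>
        mmeet M a (mjoin M b c) = mjoin M (mmeet M a b) (mmeet M a c)"
  and ex_compl: "a \<in> mcar M \<Longrightarrow> \<exists>b\<in>mcar M. mmeet M a b = mbot M \<and> mjoin M a b = mtop M"
  using mt unfolding mt_algebra_def complete_ba_def by meson+

lemma box_closed: "a \<in> mcar M \<Longrightarrow> mbox M a \<in> mcar M"
  and box_top: "mbox M (mtop M) = mtop M"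
  and box_meet: "a \<in> mcar M \<Longrightarrow> b \<in> mcar M \<Longrightarrow> mbox M (mmeet M a b) = mmeet M (mbox M a) (mbox M b)"
  and box_le: "a \<in> mcar M \<Longrightarrow> mle M (mbox M a) a"
  and box_box: "a \<in> mcar M \<Longrightarrow> mle M (mbox M a) (mbox M (mbox M a))"
  using mt unfolding mt_algebra_def by meson+

lemma is_lub_msup:
  assumes "S \<subseteq> mcar M" shows "is_lub M S (msup M S)"
proof -
  obtain a where a: "is_lub M S a" using ex_lub assms by blast
  moreover have "b = a" if "is_lub M S b" for b
    using a that antisym[of b a] unfolding is_lub_def by blast
  ultimately show ?thesis unfolding msup_def by (rule theI)
qed

lemma is_glb_minf:
  assumes "S \<subseteq> mcar M" shows "is_glb M S (minf M S)"
proof -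
  \<comment> \<open>Only suprema are postulated, so the infimum is built as the supremum of all
    lower bounds.\<close>
  let ?L = "{b \<in> mcar M. \<forall>s\<in>S. mle M b s}"
  obtain a where a: "is_lub M ?L a" using ex_lub[of ?L] by blast
  then have "is_glb M S a" using assms unfolding is_lub_def is_glb_def by blast
  moreover have "b = a" if "is_glb M S b" for b
    using \<open>is_glb M S a\<close> that antisym[of b a] unfolding is_glb_def by blast
  ultimately show ?thesis unfolding minf_def by (rule theI)
qed

lemma bot: "mbot M \<in> mcar M" "a \<in> mcar M \<Longrightarrow> mle M (mbot M) a"
  using is_lub_msup[of "{}"] by (auto simp: mbot_def is_lub_def)

lemma top: "mtop M \<in> mcar M" "a \<in> mcar M \<Longrightarrow> mle M a (mtop M)"
  using is_glb_minf[of "{}"] by (auto simp: mtop_def is_glb_def)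

lemma join:
  assumes "a \<in> mcar M" "b \<in> mcar M"
  shows "mjoin M a b \<in> mcar M" "mle M a (mjoin M a b)" "mle M b (mjoin M a b)"
    "c \<in> mcar M \<Longrightarrow> mle M a c \<Longrightarrow> mle M b c \<Longrightarrow> mle M (mjoin M a b) c"
  using is_lub_msup[of "{a, b}"] assms by (auto simp: mjoin_def is_lub_def)

lemma meet:
  assumes "a \<in> mcar M" "b \<in> mcar M"
  shows "mmeet M a b \<in> mcar M" "mle M (mmeet M a b) a" "mle M (mmeet M a b) b"
    "c \<in> mcar M \<Longrightarrow> mle M c a \<Longrightarrow> mle M c b \<Longrightarrow> mle M c (mmeet M a b)"
  using is_glb_minf[of "{a, b}"] assms by (auto simp: mmeet_def is_glb_def)

lemma meet_absorb: "a \<in> mcar M \<Longrightarrow> b \<in> mcar M \<Longrightarrow> mle M a b \<Longrightarrow> mmeet M a b = a"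
  by (intro antisym meet refl)

lemma atom_mcar: "atom M x \<Longrightarrow> x \<in> mcar M"
  by (simp add: atom_def)

lemma atom_not_le_bot: "atom M x \<Longrightarrow> \<not> mle M x (mbot M)"
  using antisym[of x "mbot M"] bot unfolding atom_def by blast

text \<open>The meet of \<open>x\<close> and \<open>a\<close> is below the atom \<open>x\<close> and
  differs from it, hence is bottom; distributing \<open>x\<close> over the join of \<open>a\<close>
  and \<open>b\<close> then leaves only the meet of \<open>x\<close> and \<open>b\<close>.\<close>

lemma atom_le_compl:
  assumes x: "atom M x" and ab: "a \<in> mcar M" "b \<in> mcar M" "mjoin M a b = mtop M" "\<not> mle M x a"
  shows "mle M x b"
proof -
  have xM: "x \<in> mcar M" using x by (rule atom_mcar)
  have "mmeet M x a \<noteq> x" using meet(3)[OF xM ab(1)] ab(4) by metis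
  then have *: "mmeet M x a = mbot M" using x meet(1,2)[OF xM ab(1)] unfolding atom_def by blast
  have "x = mmeet M x (mjoin M a b)" using meet_absorb[OF xM top(1) top(2)[OF xM]] ab(3) by simp
  also have "\<dots> = mjoin M (mbot M) (mmeet M x b)" using distrib[OF xM ab(1,2)] * by simp
  finally have "mle M x (mmeet M x b)"
    using join(4)[OF bot(1) meet(1)[OF xM ab(2)] meet(1)[OF xM ab(2)]
        bot(2)[OF meet(1)[OF xM ab(2)]] refl[OF meet(1)[OF xM ab(2)]]] by simp
  then show ?thesis using trans[OF xM meet(1)[OF xM ab(2)] ab(2)] meet(3)[OF xM ab(2)] by blast
qed

lemma eta_meet:
  assumes "a \<in> mcar M" "b \<in> mcar M" shows "eta M (mmeet M a b) = eta M a \<inter> eta M b"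
proof -
  have "mle M x (mmeet M a b) \<longleftrightarrow> mle M x a \<and> mle M x b" if "x \<in> mcar M" for x
    using meet[OF assms] trans[OF that meet(1)[OF assms]] assms that by blast
  then show ?thesis unfolding eta_def using atom_mcar by blast
qed

text \<open>Spatiality enters here: \<open>eta M\<close> is injective and preserves meets, so an
  inclusion of atoms makes the meet of \<open>a\<close> and \<open>b\<close> equal to
  \<open>a\<close>.\<close>

lemma le_iff_eta:
  assumes "a \<in> mcar M" "b \<in> mcar M" shows "mle M a b \<longleftrightarrow> eta M a \<subseteq> eta M b"
proof
  assume "mle M a b"
  then show "eta M a \<subseteq> eta M b" using meet_absorb[OF assms] eta_meet[OF assms] by auto
next
  assume "eta M a \<subseteq> eta M b"
  then have "eta M (mmeet M a b) = eta M a" using eta_meet[OF assms] by blast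
  then have "mmeet M a b = a"
    using spatial meet(1)[OF assms] assms unfolding spatial_mt_def inj_on_def by blast
  then show "mle M a b" using meet(3)[OF assms] by simp
qed

text \<open>The supremum of \<open>S\<close> has no further atoms below it. If \<open>x\<close> were
  one, every atom in \<open>S\<close> would lie below the complement \<open>b\<close> of
  \<open>x\<close>, hence so would the supremum and \<open>x\<close> itself, which is
  impossible.\<close>

lemma obtain_eta:
  assumes S: "S \<subseteq> {x. atom M x}" obtains a where "a \<in> mcar M" "eta M a = S"
proof
  have SM: "S \<subseteq> mcar M" using S atom_mcar by blast
  note lub = is_lub_msup[OF SM]
  then show a: "msup M S \<in> mcar M" by (simp add: is_lub_def)
  show "eta M (msup M S) = S"
  proof
    show "S \<subseteq> eta M (msup M S)" using S lub unfolding is_lub_def eta_def by blast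
    show "eta M (msup M S) \<subseteq> S"
    proof
      fix x assume "x \<in> eta M (msup M S)"
      then have x: "atom M x" "mle M x (msup M S)" by (auto simp: eta_def)
      have xM: "x \<in> mcar M" using x atom_mcar by blast
      obtain b where b: "b \<in> mcar M" "mmeet M x b = mbot M" "mjoin M x b = mtop M"
        using ex_compl[OF xM] by blast
      show "x \<in> S"
      proof (rule ccontr)
        assume "x \<notin> S"
        have "mle M s b" if s: "s \<in> S" for s
        proof -
          have "atom M s" using S s by blast
          then have "\<not> mle M s x" using x \<open>x \<notin> S\<close> s unfolding atom_def by blast
          then show ?thesis using atom_le_compl[OF \<open>atom M s\<close> xM b(1,3)] by blast
        qed
        then have "mle M (msup M S) b" using lub b(1) unfolding is_lub_def by blast
        then have "mle M x b" using trans[OF xM a b(1) x(2)] by blast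
        then have "mle M x (mbot M)" using meet(4)[OF xM b(1) xM refl[OF xM]] b(2) by simp
        then show False using atom_not_le_bot[OF x(1)] by blast
      qed
    qed
  qed
qed

lemma eta_top: "eta M (mtop M) = {x. atom M x}"
  unfolding eta_def using top atom_mcar by blast

lemma box_mono:
  assumes "a \<in> mcar M" "b \<in> mcar M" "mle M a b" shows "mle M (mbox M a) (mbox M b)"
  using box_meet[OF assms(1,2)] meet_absorb[OF assms] meet(3)[OF box_closed box_closed, OF assms(1,2)]
  by simp

lemma openin_atsp: "openin (atsp M) S \<longleftrightarrow> (\<exists>u. mopen M u \<and> S = eta M u)"
proof -
  have "istopology (\<lambda>S. \<exists>u. mopen M u \<and> S = eta M u)"
    unfolding istopology_def
  proof (intro conjI allI impI)
    fix S T assume "\<exists>u. mopen M u \<and> S = eta M u" "\<exists>u. mopen M u \<and> T = eta M u"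
    then obtain u v where "mopen M u" "S = eta M u" "mopen M v" "T = eta M v" by blast
    then show "\<exists>u. mopen M u \<and> S \<inter> T = eta M u"
      using eta_meet[of u v] meet(1)[of u v] box_meet[of u v] unfolding mopen_def by metis
  next
    fix \<K> assume K: "\<forall>S\<in>\<K>. \<exists>u. mopen M u \<and> S = eta M u"
    then have "\<Union>\<K> \<subseteq> {x. atom M x}" unfolding eta_def by blast
    then obtain a where a: "a \<in> mcar M" "eta M a = \<Union>\<K>" using obtain_eta by blast
    \<comment> \<open>The element \<open>a\<close> representing the union is open: each open
      \<open>u\<close> below \<open>a\<close> satisfies \<open>u = mbox M u\<close>, so it lies
      below \<open>mbox M a\<close>, and therefore \<open>a\<close> does too.\<close>
    have "eta M u \<subseteq> eta M (mbox M a)" if "mopen M u" "eta M u \<in> \<K>" for u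
    proof -
      have u: "u \<in> mcar M" "mbox M u = u" using that by (auto simp: mopen_def)
      then have "mle M u a" using le_iff_eta a that by blast
      then have "mle M u (mbox M a)" using box_mono[OF u(1) a(1)] u(2) by simp
      then show ?thesis using le_iff_eta[OF u(1) box_closed[OF a(1)]] by blast
    qed
    then have "eta M a \<subseteq> eta M (mbox M a)" using a K by fastforce
    then have "mbox M a = a"
      using le_iff_eta a(1) box_closed[OF a(1)] box_le[OF a(1)] antisym by blast
    then show "\<exists>u. mopen M u \<and> \<Union>\<K> = eta M u" using a unfolding mopen_def by blast
  qed
  then show ?thesis by (simp add: atsp_def topology_inverse')
qed

lemma topspace_atsp: "topspace (atsp M) = {x. atom M x}"
proof
  have "openin (atsp M) (eta M (mtop M))"
    using openin_atsp top(1) box_top unfolding mopen_def by blast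
  then show "{x. atom M x} \<subseteq> topspace (atsp M)" using openin_subset eta_top by metis
  show "topspace (atsp M) \<subseteq> {x. atom M x}"
    using openin_topspace[of "atsp M"] unfolding openin_atsp eta_def by blast
qed

text \<open>\<open>mbox M a\<close> is the greatest open element below \<open>a\<close>, which is
  the characterization of the interior.\<close>

lemma interior_eta:
  assumes a: "a \<in> mcar M" shows "atsp M interior_of eta M a = eta M (mbox M a)"
proof (rule interior_of_unique)
  have b: "mbox M a \<in> mcar M" by (rule box_closed[OF a])
  show "eta M (mbox M a) \<subseteq> eta M a" using le_iff_eta[OF b a] box_le[OF a] by blast
  have "mopen M (mbox M a)"
    unfolding mopen_def using b box_closed[OF b] box_le[OF b] box_box[OF a] antisym by blast
  then show "openin (atsp M) (eta M (mbox M a))" using openin_atsp by blast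
  fix T assume T: "T \<subseteq> eta M a" "openin (atsp M) T"
  then obtain u where u: "u \<in> mcar M" "mbox M u = u" "T = eta M u"
    unfolding openin_atsp mopen_def by blast
  then have "mle M u (mbox M a)" using box_mono[OF u(1) a] T le_iff_eta[OF u(1) a] by simp
  then show "T \<subseteq> eta M (mbox M a)" using u le_iff_eta[OF u(1) b] by simp
qed

lemma rep: "mt_rep M (atsp M) (eta M)"
proof
  have "eta M ` mcar M = Pow (topspace (atsp M))"
  proof
    show "eta M ` mcar M \<subseteq> Pow (topspace (atsp M))" unfolding topspace_atsp eta_def by blast
    show "Pow (topspace (atsp M)) \<subseteq> eta M ` mcar M"
      unfolding topspace_atsp using obtain_eta by blast
  qed
  then show "bij_betw (eta M) (mcar M) (Pow (topspace (atsp M)))"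
    using spatial by (simp add: bij_betw_def spatial_mt_def)
qed (simp_all add: le_iff_eta box_closed interior_eta)

end

lemma mt_rep_spatial: "spatial_mt M \<Longrightarrow> mt_rep M (atsp M) (eta M)"
  by (intro spatial.rep spatial.intro)

lemma mem_eta_atsp: "spatial_mt M \<Longrightarrow> y \<in> topspace (atsp M) \<Longrightarrow> y \<in> eta M a \<longleftrightarrow> mle M y a"
  by (simp add: eta_def spatial.topspace_atsp spatial.intro)

section \<open>The equivalence\<close>

lemma Pmor:
  assumes f: "sober_map X Y f"
  shows "proximity (powalg Y) (powalg X) (Pmor X Y f)"
    and "openin Y U \<Longrightarrow> Pmor X Y f U = {x \<in> topspace X. U \<in> f x}"
  using prox_det_proximity[OF mt_rep_powalg mt_rep_powalg f, of "\<lambda>U. {x \<in> topspace X. U \<in> f x}"]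
  unfolding Pmor_def by (auto simp: mcar_powalg mopen_powalg)

lemma Pmor_lam:
  assumes "U \<in> mcar (powalg X)"
  shows "Pmor X X (lam X) U = pid (powalg X) U"
proof -
  have *: "Pmor X X (lam X) V = V" if "mopen (powalg X) V" for V
    using that Pmor(2)[OF sober_map_lam] openin_subset[of X V] by (auto simp: mopen_powalg lam_def)
  show ?thesis
    unfolding proximity_rep[OF mt_rep_powalg mt_rep_powalg Pmor(1)[OF sober_map_lam] assms]
      pid_rep(2)[OF mt_rep_powalg assms]
    by (rule pairs_below_cong) (rule *)
qed

text \<open>On an open \<open>V\<close> both sides are the iterated pullback, along \<open>g\<close>
  and then along \<open>f\<close>; this is what \<open>scomp_eq\<close> says about membership of
  \<open>V\<close> in the composite.\<close>

lemma Pmor_scomp: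
  assumes f: "sober_map X Y f" and g: "sober_map Y Z g" and U: "U \<in> mcar (powalg Z)"
  shows "Pmor X Z (scomp Y Z g f) U = pcomp (powalg Z) (powalg X) (Pmor X Y f) (Pmor Y Z g) U"
proof -
  note fg = sober_map_scomp[OF f g]
  have *: "Pmor X Z (scomp Y Z g f) V = Pmor X Y f (Pmor Y Z g V)" if "mopen (powalg Z) V" for V
  proof -
    have V: "openin Z V" using that by (simp add: mopen_powalg)
    have "V \<in> scomp Y Z g f x \<longleftrightarrow> {y \<in> topspace Y. V \<in> g y} \<in> f x" if "x \<in> topspace X" for x
      using scomp_eq[of Y f x Z g, OF sober_map_cpf[OF f that] g] V by simp
    then show ?thesis
      using Pmor(2)[OF fg V] Pmor(2)[OF g V] Pmor(2)[OF f sober_map_openin[OF g V]] by auto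
  qed
  show ?thesis
    unfolding proximity_rep[OF mt_rep_powalg mt_rep_powalg Pmor(1)[OF fg] U]
      pcomp_rep(2)[OF mt_rep_powalg mt_rep_powalg mt_rep_powalg Pmor(1)[OF g] Pmor(1)[OF f] U]
    by (rule pairs_below_cong) (rule *)
qed

text \<open>Rewrites the order as membership in \<open>eta\<close>, the form in which the results on
  representations apply.\<close>

lemma atmor_eq:
  assumes "spatial_mt N" "y \<in> topspace (atsp N)"
  shows "atmor M N g y = {eta M u | u. mopen M u \<and> y \<in> eta N (g u)}"
  unfolding atmor_def using mem_eta_atsp[OF assms] by simp

lemma mem_atmor:
  assumes "spatial_mt M" "spatial_mt N" "y \<in> topspace (atsp N)" "mopen M u"
  shows "eta M u \<in> atmor M N g y \<longleftrightarrow> y \<in> eta N (g u)"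
  unfolding atmor_eq[OF assms(2,3)] by (rule mem_opens_iff[OF mt_rep_spatial[OF assms(1)] assms(4)])

lemma sober_map_atmor:
  assumes M: "spatial_mt M" and N: "spatial_mt N" and g: "proximity M N g"
  shows "sober_map (atsp N) (atsp M) (atmor M N g)"
  using sober_map_of_proximity[OF mt_rep_spatial[OF M] mt_rep_spatial[OF N] g]
  by (simp add: sober_map_iff atmor_eq[OF N] cong: conj_cong)

lemma atmor_pid:
  assumes M: "spatial_mt M" and y: "y \<in> topspace (atsp M)"
  shows "atmor M M (pid M) y = lam (atsp M) y"
proof -
  have "{eta M u | u. mopen M u \<and> y \<in> eta M (pid M u)} = {eta M u | u. mopen M u \<and> y \<in> eta M u}"
    using pid_mopen[OF mt_rep_spatial[OF M]] by (simp cong: conj_cong)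
  then show ?thesis
    unfolding atmor_eq[OF M y] lam_def spatial.openin_atsp[OF spatial.intro[OF M]] by blast
qed

text \<open>Pulling opens back along \<open>atmor M N g\<close> is \<open>g\<close> itself, up to
  \<open>eta\<close>. Composition and naturality of the counit both rest on this.\<close>

lemma eta_pullback_atmor:
  assumes M: "spatial_mt M" and N: "spatial_mt N" and g: "proximity M N g" and u: "mopen M u"
  shows "{y \<in> topspace (atsp N). eta M u \<in> atmor M N g y} = eta N (g u)"
proof -
  have "g u \<in> mcar N" using proximity_mcar[OF g] u by (simp add: mopen_def)
  then show ?thesis
    using mem_atmor[OF M N _ u] mt_rep.e_subset[OF mt_rep_spatial[OF N]] by blast
qed

lemma atmor_pcomp:
  assumes M: "spatial_mt M" and N: "spatial_mt N" and K: "spatial_mt K"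
    and g: "proximity M N g" and h: "proximity N K h" and z: "z \<in> topspace (atsp K)"
  shows "atmor M K (pcomp M K h g) z = scomp (atsp N) (atsp M) (atmor M N g) (atmor N K h) z"
proof -
  have "scomp (atsp N) (atsp M) (atmor M N g) (atmor N K h) z =
      {U. openin (atsp M) U \<and> {y \<in> topspace (atsp N). U \<in> atmor M N g y} \<in> atmor N K h z}"
    by (rule scomp_eq[where f = "atmor N K h",
          OF sober_map_cpf[OF sober_map_atmor[OF N K h] z] sober_map_atmor[OF M N g]])
  also have "\<dots> = {eta M u | u. mopen M u \<and> z \<in> eta K (h (g u))}"
  proof -
    have "{y \<in> topspace (atsp N). eta M u \<in> atmor M N g y} \<in> atmor N K h z \<longleftrightarrow> z \<in> eta K (h (g u))"
      if "mopen M u" for u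
      unfolding eta_pullback_atmor[OF M N g that]
      by (rule mem_atmor[OF N K z proximity_mopen[OF g that]])
    then show ?thesis
      unfolding spatial.openin_atsp[OF spatial.intro[OF M]]
      by (intro set_eqI iffI; clarsimp) metis+
  qed
  also have "\<dots> = atmor M K (pcomp M K h g) z"
    unfolding atmor_eq[OF K z]
    using pcomp_mopen[OF mt_rep_spatial[OF M] mt_rep_spatial[OF N] mt_rep_spatial[OF K] g h]
    by (simp cong: conj_cong)
  finally show ?thesis by simp
qed

section \<open>The unit: a space and the atoms of its powerset\<close>

lemma topspace_atsp_powalg: "topspace (atsp (powalg X)) = (\<lambda>x. {x}) ` topspace X"
  using spatial.topspace_atsp[OF spatial.intro[OF spatial_powalg[of X]]] by (auto simp: atom_powalg)

lemma openin_atsp_powalg: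
  "openin (atsp (powalg X)) S \<longleftrightarrow> (\<exists>U. openin X U \<and> S = (\<lambda>x. {x}) ` U)"
  unfolding spatial.openin_atsp[OF spatial.intro[OF spatial_powalg]] mopen_powalg
  using eta_powalg[OF openin_subset] by metis

lemma continuous_map_singleton: "continuous_map X (atsp (powalg X)) (\<lambda>x. {x})"
  unfolding continuous_map
proof (intro conjI allI impI)
  show "(\<lambda>x. {x}) ` topspace X \<subseteq> topspace (atsp (powalg X))" by (simp add: topspace_atsp_powalg)
  fix S assume "openin (atsp (powalg X)) S"
  then obtain U where U: "openin X U" "S = (\<lambda>x. {x}) ` U" by (auto simp: openin_atsp_powalg)
  then have "{x \<in> topspace X. {x} \<in> S} = U" using openin_subset by blast
  then show "openin X {x \<in> topspace X. {x} \<in> S}" using U by simp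
qed

text \<open>Continuity of the inverse of \<open>x \<mapsto> {x}\<close>, so that \<open>X\<close>
  and the atoms of its powerset are homeomorphic.\<close>

lemma continuous_map_the_elem: "continuous_map (atsp (powalg X)) X the_elem"
  unfolding continuous_map
proof (intro conjI allI impI)
  show "the_elem ` topspace (atsp (powalg X)) \<subseteq> topspace X" by (auto simp: topspace_atsp_powalg)
  fix U assume U: "openin X U"
  then have "{z \<in> topspace (atsp (powalg X)). the_elem z \<in> U} = (\<lambda>x. {x}) ` U"
    using openin_subset by (fastforce simp: topspace_atsp_powalg)
  then show "openin (atsp (powalg X)) {z \<in> topspace (atsp (powalg X)). the_elem z \<in> U}"
    using U by (auto simp: openin_atsp_powalg)
qed

lemma sober_map_unitS: "sober_map X (atsp (powalg X)) (unitS X)"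
  unfolding unitS_def by (rule sober_map_lam_comp[OF continuous_map_singleton])

lemma sober_iso_unitS: "sober_iso X (atsp (powalg X)) (unitS X)"
  unfolding sober_iso_def
proof (intro conjI exI ballI)
  show "sober_map X (atsp (powalg X)) (unitS X)" by (rule sober_map_unitS)
  \<comment> \<open>The inverse is the sober map of \<open>the_elem\<close>;
    \<open>scomp_lam\<close> reduces both composites to those of ordinary functions.\<close>
  show d: "sober_map (atsp (powalg X)) X (\<lambda>z. lam X (the_elem z))"
    by (rule sober_map_lam_comp[OF continuous_map_the_elem])
  show "scomp (atsp (powalg X)) X (\<lambda>z. lam X (the_elem z)) (unitS X) x = lam X x"
    if "x \<in> topspace X" for x
    unfolding unitS_def
    using scomp_lam[OF _ that d, of "\<lambda>x. {x}"] by (simp add: topspace_atsp_powalg)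
  show "scomp X (atsp (powalg X)) (unitS X) (\<lambda>z. lam X (the_elem z)) z = lam (atsp (powalg X)) z"
    if "z \<in> topspace (atsp (powalg X))" for z
  proof -
    have "scomp X (atsp (powalg X)) (unitS X) (\<lambda>z. lam X (the_elem z)) z = unitS X (the_elem z)"
      by (rule scomp_lam[OF _ that sober_map_unitS]) (auto simp: topspace_atsp_powalg)
    moreover have "{the_elem z} = z" using that by (auto simp: topspace_atsp_powalg)
    ultimately show ?thesis by (simp add: unitS_def)
  qed
qed

lemma unitS_natural:
  assumes f: "sober_map X Y f" and x: "x \<in> topspace X"
  shows "scomp (atsp (powalg X)) (atsp (powalg Y)) (atmor (powalg Y) (powalg X) (Pmor X Y f)) (unitS X) x
    = scomp Y (atsp (powalg Y)) (unitS Y) f x"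
proof -
  have "scomp (atsp (powalg X)) (atsp (powalg Y)) (atmor (powalg Y) (powalg X) (Pmor X Y f)) (unitS X) x
      = atmor (powalg Y) (powalg X) (Pmor X Y f) {x}"
    unfolding unitS_def
    by (rule scomp_lam[OF _ x sober_map_atmor[OF spatial_powalg spatial_powalg Pmor(1)[OF f]]])
      (auto simp: topspace_atsp_powalg)
  \<comment> \<open>The common value of both sides of the square: the filter \<open>f x\<close>
    carried along \<open>y \<mapsto> {y}\<close>.\<close>
  also have "\<dots> = {(\<lambda>y. {y}) ` U | U. openin Y U \<and> U \<in> f x}"
  proof -
    have "mle (powalg X) {x} (Pmor X Y f U) \<longleftrightarrow> U \<in> f x" if "openin Y U" for U
      using Pmor(2)[OF f that] x by (simp add: powalg_def)
    then show ?thesis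
      unfolding atmor_def mopen_powalg
      by (intro Collect_cong ex_cong1) (auto simp: eta_powalg openin_subset)
  qed
  also have "\<dots> = {V. openin (atsp (powalg Y)) V \<and> {y \<in> topspace Y. V \<in> unitS Y y} \<in> f x}"
  proof -
    have "{y \<in> topspace Y. (\<lambda>y. {y}) ` U \<in> unitS Y y} = U" if "openin Y U" for U
      using that openin_subset[OF that] by (auto simp: unitS_def lam_def openin_atsp_powalg)
    then show ?thesis unfolding openin_atsp_powalg by force
  qed
  also have "\<dots> = scomp Y (atsp (powalg Y)) (unitS Y) f x"
    by (rule scomp_eq[where f = f, OF sober_map_cpf[OF f x] sober_map_unitS, symmetric])
  finally show ?thesis .
qed

section \<open>The counit: a spatial algebra and the powerset of its atoms\<close>

lemma counitP:
  assumes M: "spatial_mt M"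
  shows "proximity M (powalg (atsp M)) (counitP M)"
    and "mopen M u \<Longrightarrow> counitP M u = eta M u"
proof -
  note rep = mt_rep_spatial[OF M]
  \<comment> \<open>On opens \<open>eta M\<close> is pullback along the identity sober map, hence
    has a proximity extension. Off the opens this extension can differ from \<open>eta M\<close>,
    which violates (P4) when some element is not a join of locally closed ones.\<close>
  have "eta M u \<in> mcar (powalg (atsp M)) \<and>
      eta M u = {x \<in> topspace (atsp M). eta M u \<in> lam (atsp M) x}" if "mopen M u" for u
    using that mt_rep.mopen_iff[OF rep] mt_rep.e_subset[OF rep] by (auto simp: mcar_powalg lam_def)
  from prox_det_proximity[OF rep mt_rep_powalg sober_map_lam this]
  show "proximity M (powalg (atsp M)) (counitP M)" "mopen M u \<Longrightarrow> counitP M u = eta M u"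
    unfolding counitP_def by blast+
qed

lemma pcomp_eq_pid:
  assumes M: "mt_rep M Y e" and N: "mt_rep N X d"
    and g: "proximity M N g" and h: "proximity N M h"
    and eq: "\<And>u. mopen M u \<Longrightarrow> h (g u) = u" and a: "a \<in> mcar M"
  shows "pcomp M M h g a = pid M a"
proof -
  have "e (pcomp M M h g a) = e (pid M a)"
    unfolding pcomp_rep(2)[OF M N M g h a] pid_rep(2)[OF M a]
    by (rule pairs_below_cong) (simp add: eq)
  then show ?thesis
    using mt_rep.eq_iff[OF M] pcomp_rep(1)[OF M N M g h a] pid_rep(1)[OF M a] by blast
qed

lemma prox_iso_counitP:
  assumes M: "spatial_mt M"
  shows "prox_iso M (powalg (atsp M)) (counitP M)"
proof -
  interpret M: mt_rep M "atsp M" "eta M" by (rule mt_rep_spatial[OF M])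
  \<comment> \<open>The inverse extends the same identity sober map of \<open>atsp M\<close>, now
    with the powerset as source and \<open>M\<close> as target.\<close>
  obtain k where k: "proximity (powalg (atsp M)) M k"
    and k_open: "\<And>U. openin (atsp M) U \<Longrightarrow> eta M (k U) = {x \<in> topspace (atsp M). U \<in> lam (atsp M) x}"
    using ex_proximity[OF mt_rep_powalg M.mt_rep_axioms sober_map_lam] by (auto simp: mopen_powalg)
  have eta_k: "eta M (k U) = U" if "openin (atsp M) U" for U
    using k_open[OF that] openin_subset[OF that] that by (auto simp: lam_def)
  have k_eta: "k (eta M u) = u" if "mopen M u" for u
  proof -
    have "openin (atsp M) (eta M u)" using that M.mopen_iff by blast
    then have "mopen M (k (eta M u))" "eta M (k (eta M u)) = eta M u"
      using proximity_mopen[OF k] eta_k by (auto simp: mopen_powalg)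
    then show ?thesis using that M.mopen_iff M.eq_iff by blast
  qed
  have "pcomp M M k (counitP M) a = pid M a" if "a \<in> mcar M" for a
    using pcomp_eq_pid[OF M.mt_rep_axioms mt_rep_powalg counitP(1)[OF M] k _ that]
      counitP(2)[OF M] k_eta by simp
  moreover have "pcomp (powalg (atsp M)) (powalg (atsp M)) (counitP M) k b = pid (powalg (atsp M)) b"
    if "b \<in> mcar (powalg (atsp M))" for b
  proof (rule pcomp_eq_pid[OF mt_rep_powalg M.mt_rep_axioms k counitP(1)[OF M] _ that])
    fix U assume U: "mopen (powalg (atsp M)) U"
    then show "counitP M (k U) = U"
      using counitP(2)[OF M proximity_mopen[OF k U]] eta_k by (simp add: mopen_powalg)
  qed
  ultimately show ?thesis unfolding prox_iso_def using counitP(1)[OF M] k by blast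
qed

text \<open>Both composites send an open \<open>u\<close> to \<open>eta N (g u)\<close>, by
  \<open>eta_pullback_atmor\<close>; agreement on opens settles the rest.\<close>

lemma counitP_natural:
  assumes M: "spatial_mt M" and N: "spatial_mt N" and g: "proximity M N g" and a: "a \<in> mcar M"
  shows "pcomp M (powalg (atsp N)) (counitP N) g a =
    pcomp M (powalg (atsp N)) (Pmor (atsp N) (atsp M) (atmor M N g)) (counitP M) a"
proof -
  note rep = mt_rep_spatial[OF M] mt_rep_spatial[OF N]
  note s = sober_map_atmor[OF M N g]
  have *: "counitP N (g u) = Pmor (atsp N) (atsp M) (atmor M N g) (counitP M u)"
    if u: "mopen M u" for u
  proof -
    have "openin (atsp M) (eta M u)" using mt_rep.mopen_iff[OF rep(1)] u by blast
    then show ?thesis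
      using counitP(2)[OF M u] counitP(2)[OF N proximity_mopen[OF g u]] Pmor(2)[OF s]
        eta_pullback_atmor[OF M N g u] by simp
  qed
  show ?thesis
    unfolding pcomp_rep(2)[OF rep mt_rep_powalg g counitP(1)[OF N] a]
      pcomp_rep(2)[OF rep(1) mt_rep_powalg mt_rep_powalg counitP(1)[OF M] Pmor(1)[OF s] a]
    by (rule pairs_below_cong) (rule *)
qed

text \<open>The equivalence is stated as two functors with natural isomorphisms. Equations are
  restricted to carriers and underlying sets, since functions of the logic are unconstrained
  elsewhere.\<close>

theorem theorem6p16:
  fixes X :: "'a topology" and Y :: "'b topology" and Z :: "'c topology"
    and M :: "'m mtalg" and N :: "'n mtalg" and K :: "'k mtalg"
  shows
   \<comment> \<open>F = P : Top_S -> SMT_P^op is a functor\<close>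
   "spatial_mt (powalg X)
    \<and> (\<forall>f. sober_map X Y f \<longrightarrow> proximity (powalg Y) (powalg X) (Pmor X Y f))
    \<and> (\<forall>U\<in>mcar (powalg X). Pmor X X (lam X) U = pid (powalg X) U)
    \<and> (\<forall>f g. sober_map X Y f \<and> sober_map Y Z g \<longrightarrow>
         (\<forall>U\<in>mcar (powalg Z). Pmor X Z (scomp Y Z g f) U =
             pcomp (powalg Z) (powalg X) (Pmor X Y f) (Pmor Y Z g) U))
   \<comment> \<open>G = at : SMT_P^op -> Top_S is a functor\<close>
    \<and> (\<forall>g. spatial_mt M \<and> spatial_mt N \<and> proximity M N g \<longrightarrow>
         sober_map (atsp N) (atsp M) (atmor M N g))
    \<and> (spatial_mt M \<longrightarrow> (\<forall>y\<in>topspace (atsp M). atmor M M (pid M) y = lam (atsp M) y))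
    \<and> (\<forall>g h. spatial_mt M \<and> spatial_mt N \<and> spatial_mt K \<and> proximity M N g \<and> proximity N K h \<longrightarrow>
         (\<forall>z\<in>topspace (atsp K). atmor M K (pcomp M K h g) z =
             scomp (atsp N) (atsp M) (atmor M N g) (atmor N K h) z))
   \<comment> \<open>natural isomorphism Id => G F\<close>
    \<and> sober_iso X (atsp (powalg X)) (unitS X)
    \<and> (\<forall>f. sober_map X Y f \<longrightarrow>
         (\<forall>x\<in>topspace X.
            scomp (atsp (powalg X)) (atsp (powalg Y)) (atmor (powalg Y) (powalg X) (Pmor X Y f)) (unitS X) x
            = scomp Y (atsp (powalg Y)) (unitS Y) f x))
   \<comment> \<open>natural isomorphism Id => F G (in SMT_P)\<close>
    \<and> (spatial_mt M \<longrightarrow> prox_iso M (powalg (atsp M)) (counitP M))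
    \<and> (\<forall>g. spatial_mt M \<and> spatial_mt N \<and> proximity M N g \<longrightarrow>
         (\<forall>a\<in>mcar M. pcomp M (powalg (atsp N)) (counitP N) g a =
             pcomp M (powalg (atsp N)) (Pmor (atsp N) (atsp M) (atmor M N g)) (counitP M) a))"
  by (intro conjI allI impI ballI; (elim conjE)?;
      rule spatial_powalg Pmor(1) Pmor_lam Pmor_scomp sober_map_atmor atmor_pid atmor_pcomp
        sober_iso_unitS unitS_natural prox_iso_counitP counitP_natural; assumption)

end
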